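(* Let $(A,(m_p)_{p\in\mathcal P})$ be a $\mathcal P$-tracial algebra and let $A_1$ be a classical family of elements of $A$. For any integer $k$, any $p\in\mathcal P_k$ and any $(a_1,\dots,a_k)\in A_1^k$, $$\kappa_p(a_1,\dots,a_k)=\prod_{b\in p\vee\mathrm{id}_k}\delta_{p_{|b}=0_{\#b/2}}\ \mathrm{cum}_{\#b/2}\big((a_i)_{i\in b\cap\{1,\dots,k\}}\big),$$ where the classical cumulants $\mathrm{cum}$ are defined recursively by the requirement that for any integer $n$ and any $(a_1,\dots,a_n)$, $$m_{0_n}(a_1,\dots,a_n)=\sum_{\pi\in \mathsf P_n}\prod_{b\in\pi}\mathrm{cum}_{\#b}\big((a_i)_{i\in b}\big),$$ with $\mathsf P_n$ the set of partitions of $\{1,\dots,n\}$.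
   Context: Partitions. For $k\ge 0$, $\mathcal P_k$ is the set of partitions of $\{1,\dots,k,1',\dots,k'\}$ and $\mathcal P=\bigcup_k\mathcal P_k$. A partition is drawn as a diagram with a top row $1,\dots,k$ and a bottom row $1',\dots,k'$. $\mathrm{nc}(p)$ is the number of blocks of $p$; $p\vee p'$ is the finest partition coarser than both; $\mathrm{id}_k=\{\{i,i'\}:1\le i\le k\}$; $0_k=\{\{1,\dots,k,1',\dots,k'\}\}$. $p$ is irreducible if $\mathrm{nc}(p\vee\mathrm{id}_k)=1$. For a block $b$ of $p\vee\mathrm{id}_k$, $p_{|b}\in\mathcal P_{\#b/2}$ is the partition formed by the blocks of $p$ contained in $b$, relabelled increasingly. $\delta_X$ is $1$ if $X$ holds, $0$ otherwise. A permutation $\sigma$ is identified with $\{\{i,\sigma(i)'\}\}$. $p\circ p'$ is obtained by putting $p'$ above $p$, identifying the bottom row of $p'$ with the top row of $p$, then erasing the middle row and keeping connections. $p\otimes p'$ is obtained by putting $p'$ to the right of $p$. Set $d(p,p')=\frac{\mathrm{nc}(p)+\mathrm{nc}(p')}{2}-\mathrm{nc}(p\vee p')$ and $p\le p'$ if $d(\mathrm{id}_k,p)+d(p,p')=d(\mathrm{id}_k,p')$ (a partial order). $\mathcal P$-tracial algebra. For $p\in\mathcal P_k$, $l\ge k$ and $1\le i_1<\dots<i_k\le l$, $\mathrm{Ins}^l_{(i_1,\dots,i_k)}(p)\in\mathcal P_l$ is obtained by relabelling $j\mapsto i_j$, $j'\mapsto i_j'$ in $p$ and adding the blocks $\{i,i'\}$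 for $i\notin\{i_1,\dots,i_k\}$. A $\mathcal P$-tracial algebra $(A,(m_p)_{p\in\mathcal P})$ is a (complex) algebra $A$ with $k$-linear forms $m_p:A^k\to\mathbb C$ for $p\in\mathcal P_k$ ($m_\emptyset=1$) such that (1) $m_p(a_1,\dots,a_k)=m_{\sigma\circ p\circ\sigma^{-1}}(a_{\sigma^{-1}(1)},\dots,a_{\sigma^{-1}(k)})$ for all $\sigma\in\mathfrak S_k$; (2) $m_p\big(\prod_{i=1}^{n_1}a^{(1)}_i,\dots,\prod_{i=1}^{n_k}a_i^{(k)}\big)=m_{\mathrm{Ins}^{n}_{\mathbf i}(p)\circ\sigma}(a^{(1)}_1,\dots,a^{(1)}_{n_1},\dots,a^{(k)}_1,\dots,a^{(k)}_{n_k})$, with $n=\sum_j n_j$, $\mathbf i=(1,1+n_1,\dots,1+n_1+\dots+n_{k-1})$ and $\sigma=(1,\dots,n_1)(n_1+1,\dots,n_1+n_2)\cdots(n_1+\dots+n_{k-1}+1,\dots,n)$. The $\mathcal P$-cumulants $(\kappa_p)$ are the unique multilinear forms with $m_p=\sum_{p'\in\mathcal P_k,\,p'\le p}\kappa_{p'}$ for all $k$, $p\in\mathcal P_k$. A family $A_1$ is deterministic if on the algebra it generates $m_{p_1\otimes p_2}(a_1,\dots,a_{k_1+k_2})=m_{p_1}(a_1,\dots,a_{k_1})m_{p_2}(a_{k_1+1},\dots,a_{k_1+k_2})$ for all $p_1\in\mathcal P_{k_1},p_2\in\mathcal P_{k_2}$ (it is equivalent to require this for elements of $A_1$). A family $A_1$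 is classical if it is deterministic and for every $k$, every irreducible $p\in\mathcal P_k$ and every $(a_1,\dots,a_k)\in A_1^k$, $m_p(a_1,\dots,a_k)=m_{0_k}(a_1,\dots,a_k)$. *)

theory Defs
  imports
    Complex_Main
    "HOL-Library.Disjoint_Sets"
    "HOL-Combinatorics.Cycles"
begin

section \<open>Partitions of two rows of points\<close>

text \<open>A point is a pair (row, column). The top row is row 0 and the bottom row is row 1, and columns
  are counted from 0: the points \<open>i\<close> and \<open>i'\<close> of the literature (\<open>1 \<le> i \<le> k\<close>) are
  \<open>(0, i - 1)\<close> and \<open>(1, i - 1)\<close>. Row 2 only occurs while stacking two diagrams.\<close>

type_synonym point = "nat \<times> nat"
type_synonym diagram = "point set set"

definition points :: "nat \<Rightarrow> point set" where
  "points k = {0, 1} \<times> {..<k}"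

definition diagrams :: "nat \<Rightarrow> diagram set" where
  "diagrams k = {p. partition_on (points k) p}"

text \<open>\<open>refines A p q\<close> says that \<open>q\<close> is coarser than \<open>p\<close>. The finest partition coarser than \<open>p\<close> and
  \<open>q\<close> is the coarsest common refinement of all the partitions coarser than both; see
  \<open>refines_join\<close> and \<open>join_finest\<close> below.\<close>

definition join :: "'a set \<Rightarrow> 'a set set \<Rightarrow> 'a set set \<Rightarrow> 'a set set" where
  "join A p q = common_refinement {r. refines A p r \<and> refines A q r}"

definition perm_diagram :: "nat \<Rightarrow> (nat \<Rightarrow> nat) \<Rightarrow> diagram" where
  "perm_diagram k \<sigma> = {{(0, i), (1, \<sigma> i)} | i. i < k}"

definition id_diagram :: "nat \<Rightarrow> diagram" where
  "id_diagram k = {{(0, i), (1, i)} | i. i < k}"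

text \<open>The empty set is removed so that this is the empty partition when \<open>k = 0\<close>.\<close>

definition zero_diagram :: "nat \<Rightarrow> diagram" where
  "zero_diagram k = {points k} - {{}}"

definition irreducible_diagram :: "nat \<Rightarrow> diagram \<Rightarrow> bool" where
  "irreducible_diagram k p \<longleftrightarrow> card (join (points k) p (id_diagram k)) = 1"

text \<open>\<open>b\<close> is meant to be a block of \<open>p \<or> id\<close>, so that its columns all have both their points in \<open>b\<close>.
  The column \<open>i\<close> is sent to its rank among the columns of \<open>b\<close>.\<close>

definition restrict_diagram :: "diagram \<Rightarrow> point set \<Rightarrow> diagram" where
  "restrict_diagram p b =
     (image (apsnd (\<lambda>i. card {j \<in> snd ` b. j < i}))) ` {c \<in> p. c \<subseteq> b}"

text \<open>\<open>comp_diagram k p q\<close> is \<open>p \<circ> q\<close>: the diagram \<open>q\<close> occupies rows 0 and 1, the diagram \<open>p\<close> occupies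
  rows 1 and 2, and row 1 is erased. The singletons complete each of them to a partition of the
  three rows without adding connections.\<close>

definition stack_diagram :: "nat \<Rightarrow> diagram \<Rightarrow> diagram \<Rightarrow> diagram" where
  "stack_diagram k p q =
     join ({0, 1, 2} \<times> {..<k})
       (q \<union> {{(2, i)} | i. i < k})
       ((image (apfst Suc)) ` p \<union> {{(0, i)} | i. i < k})"

definition comp_diagram :: "nat \<Rightarrow> diagram \<Rightarrow> diagram \<Rightarrow> diagram" where
  "comp_diagram k p q =
     (\<lambda>b. apfst (\<lambda>r. if r = 2 then 1 else r) ` {x \<in> b. fst x \<noteq> 1}) ` stack_diagram k p q - {{}}"

definition tensor_diagram :: "nat \<Rightarrow> diagram \<Rightarrow> diagram \<Rightarrow> diagram" where
  "tensor_diagram k p q = p \<union> (image (apsnd (\<lambda>i. k + i))) ` q"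

definition ins_diagram :: "nat \<Rightarrow> nat list \<Rightarrow> diagram \<Rightarrow> diagram" where
  "ins_diagram l is p =
     (image (apsnd (\<lambda>j. is ! j))) ` p \<union> {{(0, i), (1, i)} | i. i < l \<and> i \<notin> set is}"

definition diagram_dist :: "nat \<Rightarrow> diagram \<Rightarrow> diagram \<Rightarrow> real" where
  "diagram_dist k p q =
     (real (card p) + real (card q)) / 2 - real (card (join (points k) p q))"

definition diagram_le :: "nat \<Rightarrow> diagram \<Rightarrow> diagram \<Rightarrow> bool" where
  "diagram_le k p q \<longleftrightarrow>
     diagram_dist k (id_diagram k) p + diagram_dist k p q = diagram_dist k (id_diagram k) q"


section \<open>Tracial algebras indexed by diagrams\<close>

text \<open>Algebras are associative but need not have a unit.\<close>

locale complex_algebra = vector_space scale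
  for scale :: "complex \<Rightarrow> 'a::ring \<Rightarrow> 'a" +
  assumes mult_scale_left: "scale c x * y = scale c (x * y)"
    and mult_scale_right: "x * scale c y = scale c (x * y)"

inductive_set generated_algebra :: "(complex \<Rightarrow> 'a::ring \<Rightarrow> 'a) \<Rightarrow> 'a set \<Rightarrow> 'a set"
  for scale :: "complex \<Rightarrow> 'a \<Rightarrow> 'a" and S :: "'a set" where
  base: "x \<in> S \<Longrightarrow> x \<in> generated_algebra scale S"
| zero: "0 \<in> generated_algebra scale S"
| add: "x \<in> generated_algebra scale S \<Longrightarrow> y \<in> generated_algebra scale S \<Longrightarrow>
    x + y \<in> generated_algebra scale S"
| scale: "x \<in> generated_algebra scale S \<Longrightarrow> scale c x \<in> generated_algebra scale S"
| mult: "x \<in> generated_algebra scale S \<Longrightarrow> y \<in> generated_algebra scale S \<Longrightarrow>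
    x * y \<in> generated_algebra scale S"

text \<open>A family of forms is a function \<open>f\<close> such that \<open>f p [a\<^sub>1, \<dots>, a\<^sub>k]\<close> is the value of the form with
  index \<open>p\<close>; it only matters when \<open>p \<in> diagrams k\<close>. The number \<open>k\<close> is determined by \<open>p\<close>.\<close>

definition multilinear_forms ::
    "(complex \<Rightarrow> 'a::ring \<Rightarrow> 'a) \<Rightarrow> (diagram \<Rightarrow> 'a list \<Rightarrow> complex) \<Rightarrow> bool" where
  "multilinear_forms scale f \<longleftrightarrow>
     (\<forall>k. \<forall>p\<in>diagrams k. \<forall>xs i. length xs = k \<and> i < k \<longrightarrow>
        Vector_Spaces.linear scale (*) (\<lambda>x. f p (xs[i := x])))"

text \<open>The product of a nonempty list; there is no unit to start from.\<close>

fun list_product :: "'a::ring list \<Rightarrow> 'a" where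
  "list_product [] = undefined"
| "list_product (x # xs) = foldl (*) x xs"

text \<open>The starting positions of the segments of a concatenation, and the permutation of the positions
  that cyclically permutes each segment.\<close>

definition starts :: "'a list list \<Rightarrow> nat list" where
  "starts xss = map (\<lambda>j. sum_list (map length (take j xss))) [0..<length xss]"

definition segment_cycles :: "'a list list \<Rightarrow> nat \<Rightarrow> nat" where
  "segment_cycles xss =
     foldr (\<circ>)
       (map (\<lambda>j. cycle_of_list [starts xss ! j ..< starts xss ! j + length (xss ! j)])
         [0..<length xss]) id"

locale P_tracial_algebra = complex_algebra scale
  for scale :: "complex \<Rightarrow> 'a::ring \<Rightarrow> 'a" +
  fixes m :: "diagram \<Rightarrow> 'a list \<Rightarrow> complex"
  assumes multilinear: "multilinear_forms scale m"
    and m_empty: "m {} [] = 1"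
    and m_permute: "\<And>k p \<sigma> xs. p \<in> diagrams k \<Longrightarrow> \<sigma> permutes {..<k} \<Longrightarrow> length xs = k \<Longrightarrow>
      m p xs =
        m (comp_diagram k (comp_diagram k (perm_diagram k \<sigma>) p) (perm_diagram k (inv \<sigma>)))
          (map (\<lambda>i. xs ! (inv \<sigma> i)) [0..<k])"
    and m_product: "\<And>k p xss n. p \<in> diagrams k \<Longrightarrow> length xss = k \<Longrightarrow> [] \<notin> set xss \<Longrightarrow>
      n = sum_list (map length xss) \<Longrightarrow>
      m p (map list_product xss) =
        m (comp_diagram n (ins_diagram n (starts xss) p) (perm_diagram n (segment_cycles xss)))
          (concat xss)"

definition P_cumulants ::
    "(complex \<Rightarrow> 'a::ring \<Rightarrow> 'a) \<Rightarrow> (diagram \<Rightarrow> 'a list \<Rightarrow> complex) \<Rightarrow>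
     (diagram \<Rightarrow> 'a list \<Rightarrow> complex) \<Rightarrow> bool" where
  "P_cumulants scale m \<kappa> \<longleftrightarrow>
     multilinear_forms scale \<kappa> \<and>
     (\<forall>k. \<forall>p\<in>diagrams k. \<forall>xs. length xs = k \<longrightarrow>
        m p xs = (\<Sum>p' | p' \<in> diagrams k \<and> diagram_le k p' p. \<kappa> p' xs))"

definition deterministic_family ::
    "(complex \<Rightarrow> 'a::ring \<Rightarrow> 'a) \<Rightarrow> (diagram \<Rightarrow> 'a list \<Rightarrow> complex) \<Rightarrow> 'a set \<Rightarrow> bool" where
  "deterministic_family scale m S \<longleftrightarrow>
     (\<forall>k\<^sub>1 k\<^sub>2. \<forall>p\<^sub>1\<in>diagrams k\<^sub>1. \<forall>p\<^sub>2\<in>diagrams k\<^sub>2. \<forall>xs ys.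
        length xs = k\<^sub>1 \<and> length ys = k\<^sub>2 \<and>
        set xs \<subseteq> generated_algebra scale S \<and> set ys \<subseteq> generated_algebra scale S \<longrightarrow>
        m (tensor_diagram k\<^sub>1 p\<^sub>1 p\<^sub>2) (xs @ ys) = m p\<^sub>1 xs * m p\<^sub>2 ys)"

definition classical_family ::
    "(complex \<Rightarrow> 'a::ring \<Rightarrow> 'a) \<Rightarrow> (diagram \<Rightarrow> 'a list \<Rightarrow> complex) \<Rightarrow> 'a set \<Rightarrow> bool" where
  "classical_family scale m S \<longleftrightarrow>
     deterministic_family scale m S \<and>
     (\<forall>k. \<forall>p\<in>diagrams k. \<forall>xs.
        irreducible_diagram k p \<and> length xs = k \<and> set xs \<subseteq> S \<longrightarrow> m p xs = m (zero_diagram k) xs)"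

text \<open>\<open>cum [a\<^sub>1, \<dots>, a\<^sub>n]\<close> is the cumulant of order \<open>n\<close>. The list \<open>nths xs b\<close> consists of the entries of
  \<open>xs\<close> with position in \<open>b\<close>, in increasing order of positions.\<close>

definition classical_cumulants ::
    "(diagram \<Rightarrow> 'a list \<Rightarrow> complex) \<Rightarrow> ('a list \<Rightarrow> complex) \<Rightarrow> bool" where
  "classical_cumulants m cum \<longleftrightarrow>
     (\<forall>xs. m (zero_diagram (length xs)) xs =
        (\<Sum>\<pi> | partition_on {..<length xs} \<pi>. \<Prod>b\<in>\<pi>. cum (nths xs b)))"


section \<open>The notions above are well defined\<close>

lemma join_bounds:
  assumes "partition_on A p" "partition_on A q"
  shows refines_join: "refines A p (join A p q)" "refines A q (join A p q)"
    and join_finest: "\<And>r. refines A p r \<Longrightarrow> refines A q r \<Longrightarrow> refines A (join A p q) r"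
proof -
  let ?R = "{r. refines A p r \<and> refines A q r}"
  have part: "partition_on A r" if "r \<in> ?R" for r
    using that by (auto simp: refines_def)
  have ne: "?R \<noteq> {}"
  proof (cases "A = {}")
    case True
    then have "{} \<in> ?R"
      using assms by (auto simp: refines_def partition_on_empty)
    then show ?thesis by blast
  next
    case False
    then have "{A} \<in> ?R"
      using assms by (auto simp: refines_def partition_on_space partition_on_def)
    then show ?thesis by blast
  qed
  show "refines A p (join A p q)" "refines A q (join A p q)"
    unfolding join_def using assms part ne by (auto intro!: common_refinement_coarsest)
  show "refines A (join A p q) r" if "refines A p r" "refines A q r" for r
    unfolding join_def using that part by (intro refines_common_refinement) auto
qed

lemma card_refines:
  assumes "finite A" "refines A p q"
  shows card_refines_le: "card q \<le> card p"
    and card_refines_eq: "card q = card p \<Longrightarrow> q = p"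
proof -
  have p: "partition_on A p" and q: "partition_on A q"
    and sub: "\<And>x. x \<in> p \<Longrightarrow> \<exists>y\<in>q. x \<subseteq> y"
    using assms(2) by (auto simp: refines_def)
  have fin: "finite p"
    using finite_elements[OF assms(1) p] .
  obtain f where f: "\<And>x. x \<in> p \<Longrightarrow> f x \<in> q \<and> x \<subseteq> f x"
    using sub by metis
  have f_eq: "f x = y" if "x \<in> p" "y \<in> q" "x \<subseteq> y" for x y
  proof -
    have "x \<noteq> {}"
      using p that(1) by (auto simp: partition_on_def)
    then have "f x \<inter> y \<noteq> {}"
      using f[OF that(1)] that(3) by blast
    then show ?thesis
      using q f[OF that(1)] that(2) by (auto simp: partition_on_def disjoint_def)
  qed
  have pq: "partition_on y {x \<in> p. x \<subseteq> y}" if "y \<in> q" for y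
    using refines_obtains_subset[OF assms(2) that] .
  have surj: "f ` p = q"
  proof
    show "f ` p \<subseteq> q"
      using f by auto
    show "q \<subseteq> f ` p"
    proof
      fix y assume y: "y \<in> q"
      then have "y \<noteq> {}"
        using q by (auto simp: partition_on_def)
      then obtain x where "x \<in> p" "x \<subseteq> y"
        using partition_onD1[OF pq[OF y]] by auto
      then show "y \<in> f ` p"
        using f_eq[OF _ y] by blast
    qed
  qed
  show "card q \<le> card p"
    using card_image_le[OF fin, of f] surj by simp
  show "q = p" if "card q = card p"
  proof -
    have inj: "inj_on f p"
      using that surj fin by (simp add: eq_card_imp_inj_on)
    have "f x = x" if x: "x \<in> p" for x
    proof -
      have "x' = x" if x': "x' \<in> p" "x' \<subseteq> f x" for x'
      proof -
        have "f x' = f x"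
          using f_eq[OF x'(1) _ x'(2)] f[OF x] by simp
        then show ?thesis
          by (rule inj_onD[OF inj _ x'(1) x])
      qed
      then have "{x' \<in> p. x' \<subseteq> f x} \<subseteq> {x}"
        by blast
      then have "f x \<subseteq> x"
        using partition_onD1[OF pq[of "f x"]] f[OF x] by blast
      then show ?thesis
        using f[OF x] by blast
    qed
    then show ?thesis
      using surj by auto
  qed
qed

lemma finite_diagrams: "finite (diagrams k)"
  unfolding diagrams_def by (rule finitely_many_partition_on) (simp add: points_def)

lemma id_diagram_in_diagrams: "id_diagram k \<in> diagrams k"
proof -
  have "disjoint (id_diagram k)"
    by (rule pairwiseI) (auto simp: id_diagram_def disjnt_def)
  moreover have "\<Union>(id_diagram k) = points k"
    by (auto simp: id_diagram_def points_def)
  ultimately show ?thesis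
    by (auto simp: diagrams_def partition_on_def id_diagram_def)
qed

lemma diagram_dist_pos:
  assumes "p \<in> diagrams k" "q \<in> diagrams k"
  shows "diagram_dist k p q \<ge> 0" "diagram_dist k p q = 0 \<longleftrightarrow> p = q"
proof -
  have p: "partition_on (points k) p" and q: "partition_on (points k) q"
    using assms by (auto simp: diagrams_def)
  have fin: "finite (points k)"
    by (simp add: points_def)
  note r = refines_join[OF p q]
  note le = card_refines_le[OF fin r(1)] card_refines_le[OF fin r(2)]
  show "diagram_dist k p q \<ge> 0"
    using le by (simp add: diagram_dist_def)
  have "join (points k) p p = p"
    using refines_asym[OF join_finest[OF p p refines_refl[OF p] refines_refl[OF p]]
      refines_join(1)[OF p p]] .
  moreover have "p = q" if "diagram_dist k p q = 0"
  proof -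
    have "card (join (points k) p q) = card p" "card (join (points k) p q) = card q"
      using le that by (auto simp: diagram_dist_def field_simps)
    then show ?thesis
      using card_refines_eq[OF fin r(1)] card_refines_eq[OF fin r(2)] by simp
  qed
  ultimately show "diagram_dist k p q = 0 \<longleftrightarrow> p = q"
    by (auto simp: diagram_dist_def)
qed

definition diagram_rank :: "nat \<Rightarrow> diagram \<Rightarrow> nat" where
  "diagram_rank k p = nat \<lfloor>2 * diagram_dist k (id_diagram k) p\<rfloor>"

lemma diagram_rank_less:
  assumes "p \<in> diagrams k" "q \<in> diagrams k" "diagram_le k p q" "p \<noteq> q"
  shows "diagram_rank k p < diagram_rank k q"
proof -
  have int: "\<exists>i::int. 2 * diagram_dist k (id_diagram k) r = of_int i" for r
    by (rule exI[of _ "int (card (id_diagram k)) + int (card r)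
        - 2 * int (card (join (points k) (id_diagram k) r))"])
      (simp add: diagram_dist_def algebra_simps)
  obtain i j where
    ij: "2 * diagram_dist k (id_diagram k) p = of_int i"
      "2 * diagram_dist k (id_diagram k) q = of_int j"
    using int by metis
  have "diagram_dist k p q > 0"
    using diagram_dist_pos[OF assms(1,2)] assms(4) by linarith
  then have "2 * diagram_dist k (id_diagram k) p < 2 * diagram_dist k (id_diagram k) q"
    using assms(3) by (simp add: diagram_le_def)
  moreover have "diagram_dist k (id_diagram k) p \<ge> 0"
    by (rule diagram_dist_pos[OF id_diagram_in_diagrams assms(1)])
  ultimately have "i < j" "0 \<le> i"
    using ij by linarith+
  then show ?thesis
    by (simp add: diagram_rank_def ij)
qed

lemma diagram_le_refl: "p \<in> diagrams k \<Longrightarrow> diagram_le k p p"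
  using diagram_dist_pos(2)[of p k p] by (simp add: diagram_le_def)

lemma sum_diagram_le:
  fixes f :: "diagram \<Rightarrow> complex"
  assumes "p \<in> diagrams k"
  shows "(\<Sum>q | q \<in> diagrams k \<and> diagram_le k q p. f q) =
    f p + (\<Sum>q | q \<in> diagrams k \<and> diagram_le k q p \<and> q \<noteq> p. f q)"
proof -
  have "{q. q \<in> diagrams k \<and> diagram_le k q p} =
      insert p {q. q \<in> diagrams k \<and> diagram_le k q p \<and> q \<noteq> p}"
    using assms diagram_le_refl by auto
  then show ?thesis
    using finite_diagrams[of k] by simp
qed

lemma P_cumulants_unique:
  assumes "P_cumulants scale m \<kappa>" "P_cumulants scale m \<kappa>'" "p \<in> diagrams k" "length xs = k"
  shows "\<kappa> p xs = \<kappa>' p xs"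
  using assms(3)
proof (induction "diagram_rank k p" arbitrary: p rule: less_induct)
  case less
  let ?L = "{q. q \<in> diagrams k \<and> diagram_le k q p \<and> q \<noteq> p}"
  have eq: "m p xs = f p xs + (\<Sum>q\<in>?L. f q xs)" if "P_cumulants scale m f" for f
    using that less.prems assms(4) sum_diagram_le[OF less.prems, of "\<lambda>q. f q xs"]
    by (simp add: P_cumulants_def)
  have "(\<Sum>q\<in>?L. \<kappa> q xs) = (\<Sum>q\<in>?L. \<kappa>' q xs)"
    using less by (intro sum.cong) (auto intro: diagram_rank_less)
  then show ?case
    using eq[OF assms(1)] eq[OF assms(2)] by simp
qed

lemma P_cumulants_exist:
  fixes scale :: "complex \<Rightarrow> 'a::ring \<Rightarrow> 'a"
  assumes "P_tracial_algebra scale m"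
  shows "\<exists>\<kappa>. P_cumulants scale m \<kappa>"
proof -
  interpret P_tracial_algebra scale m
    by fact
  define R where "R = inv_image (measure (\<lambda>(k, p). diagram_rank k p))
    (\<lambda>(p, xs :: 'a list). (length xs, p))"
  define \<kappa> where "\<kappa> = wfrec R (\<lambda>f (p, xs). m p xs -
    (\<Sum>q | q \<in> diagrams (length xs) \<and> diagram_le (length xs) q p \<and> q \<noteq> p. f (q, xs)))"
  have "wf R"
    by (simp add: R_def)
  have rec: "\<kappa> (p, xs) = m p xs - (\<Sum>q | q \<in> diagrams k \<and> diagram_le k q p \<and> q \<noteq> p. \<kappa> (q, xs))"
    if "p \<in> diagrams k" "length xs = k" for p k xs
  proof -
    have "\<kappa> (p, xs) = m p xs - (\<Sum>q | q \<in> diagrams k \<and> diagram_le k q p \<and> q \<noteq> p.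
        cut \<kappa> R (p, xs) (q, xs))"
      using that by (subst \<kappa>_def, subst wfrec[OF \<open>wf R\<close>]) (simp add: \<kappa>_def)
    also have "(\<Sum>q | q \<in> diagrams k \<and> diagram_le k q p \<and> q \<noteq> p. cut \<kappa> R (p, xs) (q, xs)) =
        (\<Sum>q | q \<in> diagrams k \<and> diagram_le k q p \<and> q \<noteq> p. \<kappa> (q, xs))"
      using that by (intro sum.cong) (auto simp: cut_def R_def diagram_rank_less)
    finally show ?thesis .
  qed
  interpret vs: vector_space_pair scale "(*) :: complex \<Rightarrow> complex \<Rightarrow> complex"
    by unfold_locales (auto simp: algebra_simps)
  have lin: "Vector_Spaces.linear scale (*) (\<lambda>x. \<kappa> (p, xs[i := x]))"
    if "p \<in> diagrams k" "length xs = k" "i < k" for p k i xs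
    using that(1)
  proof (induction "diagram_rank k p" arbitrary: p rule: less_induct)
    case less
    have "(\<lambda>x. \<kappa> (p, xs[i := x])) = (\<lambda>x. m p (xs[i := x]) -
        (\<Sum>q | q \<in> diagrams k \<and> diagram_le k q p \<and> q \<noteq> p. \<kappa> (q, xs[i := x])))"
      using rec[OF less.prems] that(2) by auto
    moreover have "Vector_Spaces.linear scale (*) (\<lambda>x. m p (xs[i := x]))"
      using multilinear less.prems that(2,3) by (auto simp: multilinear_forms_def)
    ultimately show ?case
      using less diagram_rank_less
      by (auto intro!: vs.linear_compose_sub vs.linear_compose_sum)
  qed
  have "P_cumulants scale m (\<lambda>p xs. \<kappa> (p, xs))"
    unfolding P_cumulants_def multilinear_forms_def
    using lin rec by (auto simp: sum_diagram_le)
  then show ?thesis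
    by blast
qed

lemma length_nths_less:
  assumes "partition_on {..<length xs} \<pi>" "\<pi> \<noteq> {{..<length xs}}" "b \<in> \<pi>"
  shows "length (nths xs b) < length xs"
proof -
  have sub: "c \<subseteq> {..<length xs}" "c \<noteq> {}" if "c \<in> \<pi>" for c
    using assms(1) that by (auto simp: partition_on_def)
  have "\<pi> \<noteq> {b}"
    using assms(1,2) by (auto simp: partition_on_def)
  then obtain c where c: "c \<in> \<pi>" "c \<noteq> b"
    using assms(3) by blast
  then have "c \<inter> b = {}"
    using assms(1,3) unfolding partition_on_def disjoint_def by blast
  then have "b \<subset> {..<length xs}"
    using sub[OF c(1)] sub[OF assms(3)] by blast
  then have "card b < length xs"
    using psubset_card_mono[of "{..<length xs}" b] by simp
  moreover have "{i. i < length xs \<and> i \<in> b} = b"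
    using sub(1)[OF assms(3)] by blast
  ultimately show ?thesis
    by (simp add: length_nths)
qed

lemma classical_cumulants_exist:
  fixes m :: "diagram \<Rightarrow> 'a list \<Rightarrow> complex"
  assumes "m {} [] = 1"
  shows "\<exists>cum. classical_cumulants m cum"
proof -
  define F where "F = (\<lambda>(cum :: 'a list \<Rightarrow> complex) xs. m (zero_diagram (length xs)) xs -
    (\<Sum>\<pi> | partition_on {..<length xs} \<pi> \<and> \<pi> \<noteq> {{..<length xs}}. \<Prod>b\<in>\<pi>. cum (nths xs b)))"
  define cum where "cum = wfrec (measure length) F"
  have rec: "cum xs = F cum xs" for xs
  proof -
    have "cum xs = F (cut cum (measure length) xs) xs"
      unfolding cum_def by (rule wfrec) simp
    also have "\<dots> = F cum xs"
    proof -
      have "cut cum (measure length) xs (nths xs b) = cum (nths xs b)"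
        if "partition_on {..<length xs} \<pi>" "\<pi> \<noteq> {{..<length xs}}" "b \<in> \<pi>" for \<pi> b
        using length_nths_less[OF that] by (simp add: cut_apply)
      then show ?thesis
        unfolding F_def by (intro arg_cong2[where f = "(-)"] refl sum.cong prod.cong) auto
    qed
    finally show ?thesis .
  qed
  have "m (zero_diagram (length xs)) xs =
      (\<Sum>\<pi> | partition_on {..<length xs} \<pi>. \<Prod>b\<in>\<pi>. cum (nths xs b))" for xs
  proof (cases "xs = []")
    case True
    then show ?thesis
      using assms by (simp add: zero_diagram_def points_def partition_on_empty)
  next
    case False
    let ?T = "{..<length xs}"
    have "partition_on ?T {?T}"
      using False by (intro partition_on_space) (auto simp: lessThan_empty_iff)
    then have "{\<pi>. partition_on ?T \<pi>} =
        insert {?T} {\<pi>. partition_on ?T \<pi> \<and> \<pi> \<noteq> {?T}}"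
      by auto
    moreover have "finite {\<pi>. partition_on ?T \<pi> \<and> \<pi> \<noteq> {?T}}"
      using finitely_many_partition_on[of ?T] by (rule rev_finite_subset) auto
    moreover have "nths xs ?T = xs"
      by (simp add: nths_all)
    ultimately show ?thesis
      using rec[of xs] by (simp add: F_def)
  qed
  then show ?thesis
    unfolding classical_cumulants_def by blast
qed

end

theory Submission
  imports Defs
begin

text \<open>Write \<open>i\<close> for the identity diagram. The defining relation of the cumulants, a sum over all \<open>q \<le> p\<close>,
  determines them one multi-argument at a time, by induction on the distance from \<open>i\<close>
  (\<open>diagram_sums_determine\<close>). So it is enough that the proposed products satisfy it on the family.

  The factor at a block \<open>b\<close> of \<open>p \<or> i\<close> vanishes unless \<open>b\<close> is itself a block of \<open>p\<close>; hence the product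
  vanishes unless \<open>p\<close> is coarser than \<open>i\<close>, and it is then the product of the classical cumulants over
  the blocks of \<open>p\<close> (\<open>cumulant_product_eq\<close>). For \<open>q\<close> coarser than \<open>i\<close>, we have \<open>q \<or> i = q\<close>, the number
  of blocks of \<open>q\<close> cancels in the definition of the order, and \<open>q \<le> p\<close> says that \<open>q \<or> p\<close> and
  \<open>p \<or> i\<close> have equally many blocks. As the first is coarser than the second, this means that they are
  equal, that is, that \<open>q\<close> refines \<open>p \<or> i\<close> (\<open>diagram_le_iff_refines\<close>). What has to be proved is therefore
  that \<open>m\<^sub>p\<close> is the sum, over the partitions \<open>q\<close> between \<open>i\<close> and \<open>p \<or> i\<close>, of the products of classical
  cumulants over the blocks of \<open>q\<close>.

  On one side, permuting the columns brings the blocks of \<open>p \<or> i\<close> next to each other, so that \<open>m\<^sub>p\<close>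
  factors over them because the family is deterministic; the restriction of \<open>p\<close> to each block is
  irreducible, so that the corresponding factor is a classical moment
  (\<open>m_classical_factorization\<close>). On the other side, choosing \<open>q\<close> amounts to choosing independently a
  partition of the columns of each block of \<open>p \<or> i\<close> (\<open>sum_refines_columns\<close>, \<open>sum_prod_refines\<close>), and each
  of these sums is a classical moment by the definition of the classical cumulants
  (\<open>classical_moment_nths\<close>).\<close>

section \<open>Joins of partitions\<close>

lemma refinesD:
  assumes "refines A p q"
  shows "partition_on A p" "partition_on A q" "\<And>c. c \<in> p \<Longrightarrow> \<exists>d\<in>q. c \<subseteq> d"
  using assms unfolding refines_def by blast+

lemma join_eqI:
  assumes "refines A p r" "refines A q r"
    and "\<And>s. refines A p s \<Longrightarrow> refines A q s \<Longrightarrow> refines A r s"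
  shows "join A p q = r"
proof -
  note pq = refinesD(1)[OF assms(1)] refinesD(1)[OF assms(2)]
  show ?thesis
    by (rule refines_asym[OF join_finest[OF pq assms(1,2)] assms(3)[OF refines_join[OF pq]]])
qed

lemma partition_on_image:
  assumes "partition_on A p" "inj_on f A"
  shows "partition_on (f ` A) ((`) f ` p)"
proof -
  have "{} \<notin> (`) f ` p"
    using partition_onD3[OF assms(1)] by auto
  then show ?thesis
    using partition_on_inj_image[OF assms] by simp
qed

lemma refines_image:
  assumes "refines A p q" "inj_on f A"
  shows "refines (f ` A) ((`) f ` p) ((`) f ` q)"
proof -
  have "\<exists>d\<in>(`) f ` q. c \<subseteq> d" if "c \<in> (`) f ` p" for c
    using that refinesD(3)[OF assms(1)] by (force dest: image_mono)
  then show ?thesis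
    using refinesD(1,2)[OF assms(1), THEN partition_on_image, OF assms(2)]
    unfolding refines_def by blast
qed

lemma image_inv_into_blocks:
  assumes "partition_on A p" "inj_on f A"
  shows "(`) (inv_into A f) ` (`) f ` p = p"
proof -
  have "inv_into A f ` f ` c = c" if "c \<in> p" for c
    using that partition_onD1[OF assms(1)] assms(2) by (intro inv_into_image_cancel) blast+
  then show ?thesis
    by (simp add: image_image)
qed

lemma join_image:
  assumes "partition_on A p" "partition_on A q" "inj_on f A"
  shows "join (f ` A) ((`) f ` p) ((`) f ` q) = (`) f ` join A p q"
proof (rule join_eqI)
  note j = refines_join[OF assms(1,2)]
  show "refines (f ` A) ((`) f ` p) ((`) f ` join A p q)" "refines (f ` A) ((`) f ` q) ((`) f ` join A p q)"
    by (rule refines_image[OF j(1) assms(3)] refines_image[OF j(2) assms(3)])+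
  fix s assume s: "refines (f ` A) ((`) f ` p) s" "refines (f ` A) ((`) f ` q) s"
  let ?g = "inv_into A f"
  have g: "inj_on ?g (f ` A)"
    by (rule inj_on_inv_into) simp
  have gA: "?g ` f ` A = A"
    using assms(3) by simp
  have "refines A p ((`) ?g ` s)" "refines A q ((`) ?g ` s)"
    using refines_image[OF s(1) g] refines_image[OF s(2) g]
    by (simp_all add: gA image_inv_into_blocks assms)
  then have "refines A (join A p q) ((`) ?g ` s)"
    by (rule join_finest[OF assms(1,2)])
  from refines_image[OF this assms(3)]
  have "refines (f ` A) ((`) f ` join A p q) ((`) f ` (`) ?g ` s)" .
  also have "(`) f ` (`) ?g ` s = s"
  proof -
    have "f ` ?g ` c = c" if "c \<in> s" for c
    proof -
      have "c \<subseteq> f ` A"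
        using that partition_onD1[OF refinesD(2)[OF s(1)]] by blast
      then show ?thesis by (rule image_inv_into_cancel[OF refl])
    qed
    then show ?thesis
      by (simp add: image_image)
  qed
  finally show "refines (f ` A) ((`) f ` join A p q) s" .
qed

lemma partition_on_Un:
  assumes "partition_on A p" "partition_on B q" "A \<inter> B = {}"
  shows "partition_on (A \<union> B) (p \<union> q)"
proof (rule partition_onI)
  have *: "c \<subseteq> A" if "c \<in> p" for c
    using that partition_onD1[OF assms(1)] by blast
  have **: "c \<subseteq> B" if "c \<in> q" for c
    using that partition_onD1[OF assms(2)] by blast
  fix c d assume cd: "c \<in> p \<union> q" "d \<in> p \<union> q" "c \<noteq> d"
  have "disjnt c d" if "c \<in> p" "d \<in> q" for c d
    using *[OF that(1)] **[OF that(2)] assms(3) by (auto simp: disjnt_def)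
  moreover have "disjnt c d" if "c \<in> p" "d \<in> p" "c \<noteq> d" for c d
    using that partition_onD2[OF assms(1)] by (simp add: disjointD disjnt_def)
  moreover have "disjnt c d" if "c \<in> q" "d \<in> q" "c \<noteq> d" for c d
    using that partition_onD2[OF assms(2)] by (simp add: disjointD disjnt_def)
  ultimately show "disjnt c d"
    using cd by (metis Un_iff disjnt_sym)
next
  show "\<Union>(p \<union> q) = A \<union> B"
    using partition_onD1[OF assms(1)] partition_onD1[OF assms(2)] by simp
qed (use partition_onD3[OF assms(1)] partition_onD3[OF assms(2)] in auto)

lemma partition_on_remove:
  assumes "partition_on A p" "b \<in> p"
  shows "partition_on (A - b) (p - {b})"
proof -
  have "disjnt b (\<Union>(p - {b}))"
    using assms(2) partition_onD2[OF assms(1)] unfolding disjnt_def disjoint_def by fast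
  from partition_on_insert[OF this, of A] show ?thesis
    using assms by (simp add: insert_absorb)
qed

text \<open>If the parts of \<open>p\<close> and \<open>q\<close> inside a block of their join had a finer join, then splitting the block
  accordingly would give a partition coarser than \<open>p\<close> and \<open>q\<close> but strictly finer than their join. This is
  what makes the restriction of a diagram to a block irreducible.\<close>

lemma join_block:
  assumes "partition_on A p" "partition_on A q" "b \<in> join A p q"
  shows "join b {c \<in> p. c \<subseteq> b} {c \<in> q. c \<subseteq> b} = {b}"
proof (rule join_eqI)
  let ?J = "join A p q"
  note j = refines_join[OF assms(1,2)]
  have J: "partition_on A ?J"
    by (rule refinesD(2)[OF j(1)])
  have b: "b \<noteq> {}"
    using partition_onD3[OF J] assms(3) by auto
  show "refines b {c \<in> p. c \<subseteq> b} {b}" "refines b {c \<in> q. c \<subseteq> b} {b}"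
    using refines_obtains_subset[OF j(1) assms(3)] refines_obtains_subset[OF j(2) assms(3)]
      partition_on_space[OF b]
    unfolding refines_def by blast+
  fix s assume s: "refines b {c \<in> p. c \<subseteq> b} s" "refines b {c \<in> q. c \<subseteq> b} s"
  \<comment> \<open>Replacing the block \<open>b\<close> of the join by the blocks of \<open>s\<close> gives another partition coarser than
    both.\<close>
  let ?s = "s \<union> (?J - {b})"
  have sb: "partition_on b s"
    by (rule refinesD(2)[OF s(1)])
  have rest: "partition_on (A - b) (?J - {b})"
    by (rule partition_on_remove[OF J assms(3)])
  have dis: "c \<inter> b = {}" if "c \<in> ?J - {b}" for c
    using that partition_onD1[OF rest] by blast
  have s': "partition_on A ?s"
  proof -
    have "b \<union> (A - b) = A"
      using assms(3) partition_onD1[OF J] by blast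
    then show ?thesis
      using partition_on_Un[OF sb rest] by auto
  qed
  have ref: "refines A r ?s" if r: "refines A r ?J" "refines b {c \<in> r. c \<subseteq> b} s" for r
    unfolding refines_def
  proof (intro conjI ballI)
    show "partition_on A r"
      by (rule refinesD(1)[OF r(1)])
    fix c assume c: "c \<in> r"
    then obtain d where d: "d \<in> ?J" "c \<subseteq> d"
      using refinesD(3)[OF r(1)] by blast
    show "\<exists>y\<in>?s. c \<subseteq> y"
    proof (cases "d = b")
      case True
      then show ?thesis
        using refinesD(3)[OF r(2), of c] c d(2) by blast
    qed (use d in blast)
  qed (rule s')
  have "refines A ?J ?s"
    by (rule join_finest[OF assms(1,2) ref[OF j(1) s(1)] ref[OF j(2) s(2)]])
  then obtain y where y: "y \<in> ?s" "b \<subseteq> y"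
    using refinesD(3)[of A ?J ?s b] assms(3) by blast
  then have "y \<in> s"
    using dis[of y] b by blast
  then show "refines b {b} s"
    unfolding refines_def using y sb partition_on_space[OF b] by blast
qed

text \<open>The computation behind stacking a permutation on a diagram: the points of \<open>Y\<close>, unconnected at first,
  are glued one by one to distinct points of \<open>X\<close>, so every block of \<open>p\<close> just grows by the new points
  glued to it. The singletons of either side only complete the two partitions to the union of
  \<open>X\<close> and \<open>Y\<close>.\<close>

lemma join_attach:
  assumes p: "partition_on X p" and "X \<inter> Y = {}" and g: "g ` Y \<subseteq> X" "inj_on g Y"
  shows "join (X \<union> Y) (p \<union> (\<lambda>y. {y}) ` Y) ((\<lambda>y. {g y, y}) ` Y \<union> (\<lambda>x. {x}) ` (X - g ` Y)) =
    (\<lambda>c. c \<union> {y \<in> Y. g y \<in> c}) ` p"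
    (is "join ?A ?p ?q = ?E ` p")
proof (rule join_eqI)
  have sub: "c \<subseteq> X" "c \<noteq> {}" if "c \<in> p" for c
    using that partition_onD1[OF p] partition_onD3[OF p] by blast+
  have dis: "c \<inter> d = {}" if "c \<in> p" "d \<in> p" "c \<noteq> d" for c d
    using that partition_onD2[OF p] by (simp add: disjointD)
  have cover: "\<exists>c\<in>p. x \<in> c" if "x \<in> X" for x
    using that partition_onD1[OF p] by blast
  have "partition_on Y ((\<lambda>y. {y}) ` Y)"
    by (rule partition_on_singletons)
  then have P: "partition_on ?A ?p"
    by (rule partition_on_Un[OF p _ assms(2)])
  have "partition_on (g ` Y \<union> Y) ((\<lambda>y. {g y, y}) ` Y)"
  proof (rule partition_onI)
    fix c d assume "c \<in> (\<lambda>y. {g y, y}) ` Y" "d \<in> (\<lambda>y. {g y, y}) ` Y" "c \<noteq> d"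
    then obtain y z where yz: "c = {g y, y}" "d = {g z, z}" "y \<in> Y" "z \<in> Y" "y \<noteq> z"
      by blast
    moreover have "g y \<noteq> g z"
      using inj_onD[OF g(2)] yz by blast
    moreover have "g y \<notin> Y" "g z \<notin> Y"
      using yz g(1) assms(2) by blast+
    ultimately show "disjnt c d"
      unfolding disjnt_def by blast
  qed auto
  from partition_on_Un[OF this partition_on_singletons, of "X - g ` Y"]
  have Q: "partition_on ?A ?q"
  proof -
    assume a: "(g ` Y \<union> Y) \<inter> (X - g ` Y) = {} \<Longrightarrow>
      partition_on (g ` Y \<union> Y \<union> (X - g ` Y)) ?q"
    have "(g ` Y \<union> Y) \<inter> (X - g ` Y) = {}" "g ` Y \<union> Y \<union> (X - g ` Y) = ?A"
      using assms(2) g(1) by blast+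
    then show ?thesis
      using a by simp
  qed
  have E: "partition_on ?A (?E ` p)"
  proof (rule partition_onI)
    have "y \<in> \<Union>(?E ` p)" if "y \<in> Y" for y
      using that cover[of "g y"] g(1) by blast
    moreover have "x \<in> \<Union>(?E ` p)" if "x \<in> X" for x
      using cover[OF that] by blast
    moreover have "?E c \<subseteq> ?A" if "c \<in> p" for c
      using sub(1)[OF that] by blast
    ultimately have "x \<in> \<Union>(?E ` p) \<longleftrightarrow> x \<in> ?A" for x
      by (meson UN_E UN_I Un_iff subsetD)
    then show "\<Union>(?E ` p) = ?A"
      by (rule set_eqI)
    fix c d assume "c \<in> ?E ` p" "d \<in> ?E ` p" "c \<noteq> d"
    then obtain c' d' where cd: "c = ?E c'" "d = ?E d'" "c' \<in> p" "d' \<in> p" "c' \<noteq> d'"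
      by blast
    show "disjnt c d"
      using dis[OF cd(3-5)] sub(1)[OF cd(3)] sub(1)[OF cd(4)] assms(2)
      unfolding cd(1,2) disjnt_def by blast
  qed (use sub(2) in blast)
  have "\<exists>d\<in>?E ` p. c \<subseteq> d" if "c \<in> ?p" for c
    using that
  proof
    assume "c \<in> p"
    then show ?thesis
      by (intro bexI[of _ "?E c"]) auto
  next
    assume "c \<in> (\<lambda>y. {y}) ` Y"
    then obtain y where "y \<in> Y" "c = {y}"
      by blast
    moreover then obtain d where "d \<in> p" "g y \<in> d"
      using cover[of "g y"] g(1) by blast
    ultimately show ?thesis
      by (intro bexI[of _ "?E d"]) auto
  qed
  then show "refines ?A ?p (?E ` p)"
    unfolding refines_def using P E by blast
  have "\<exists>d\<in>?E ` p. c \<subseteq> d" if "c \<in> ?q" for c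
    using that
  proof
    assume "c \<in> (\<lambda>y. {g y, y}) ` Y"
    then obtain y where y: "y \<in> Y" "c = {g y, y}"
      by blast
    then obtain d where "d \<in> p" "g y \<in> d"
      using cover[of "g y"] g(1) by blast
    then show ?thesis
      using y by (intro bexI[of _ "?E d"]) auto
  next
    assume "c \<in> (\<lambda>x. {x}) ` (X - g ` Y)"
    then obtain x where "x \<in> X" "c = {x}"
      by blast
    moreover then obtain d where "d \<in> p" "x \<in> d"
      using cover[of x] by blast
    ultimately show ?thesis
      by (intro bexI[of _ "?E d"]) auto
  qed
  then show "refines ?A ?q (?E ` p)"
    unfolding refines_def using Q E by blast
  fix s assume s: "refines ?A ?p s" "refines ?A ?q s"
  note S = refinesD(2)[OF s(1)]
  have "\<exists>d\<in>s. ?E c \<subseteq> d" if c: "c \<in> p" for c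
  proof -
    obtain d where d: "d \<in> s" "c \<subseteq> d"
      using refinesD(3)[OF s(1), of c] c by blast
    have "y \<in> d" if y: "y \<in> Y" "g y \<in> c" for y
    proof -
      obtain e where e: "e \<in> s" "{g y, y} \<subseteq> e"
        using refinesD(3)[OF s(2), of "{g y, y}"] y by blast
      have "d \<inter> e \<noteq> {}"
        using d e y by blast
      then have "e = d"
        using d(1) e(1) disjointD[OF partition_onD2[OF S], of d e] by blast
      then show ?thesis using e by blast
    qed
    then show ?thesis using d by blast
  qed
  then show "refines ?A (?E ` p) s"
    unfolding refines_def using E S by blast
qed

section \<open>Permuting the columns of a diagram\<close>

lemma join_commute: "join A p q = join A q p"
  by (simp add: join_def conj_commute)

definition relabel_columns :: "(nat \<Rightarrow> nat) \<Rightarrow> diagram \<Rightarrow> diagram" where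
  "relabel_columns f p = (`) (apsnd f) ` p"

text \<open>Composing with a permutation on one side relabels the columns in one row and leaves the other row
  alone. Here row 2 is attached to the bottom row of \<open>p\<close>, which then disappears; in the next lemma row 0
  is attached to the top row.\<close>

lemma comp_perm_diagram_left:
  assumes p: "p \<in> diagrams k" and \<sigma>: "\<sigma> permutes {..<k}"
  shows "comp_diagram k (perm_diagram k \<sigma>) p = (`) (\<lambda>(r, i). (r, if r = 1 then \<sigma> i else i)) ` p"
    (is "_ = (`) ?F ` p")
proof -
  have part: "partition_on (points k) p"
    using p by (simp add: diagrams_def)
  define Y where "Y = {2 :: nat} \<times> {..<k}"
  define g where "g = (\<lambda>(r :: nat, j). (1 :: nat, inv \<sigma> j))"
  have inv: "inv \<sigma> i < k \<longleftrightarrow> i < k" "\<sigma> (inv \<sigma> i) = i" "inv \<sigma> (\<sigma> i) = i" "\<sigma> i < k \<longleftrightarrow> i < k" for i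
    using permutes_in_image[OF permutes_inv[OF \<sigma>]] permutes_in_image[OF \<sigma>] permutes_inverses[OF \<sigma>]
    by auto
  have gY: "g ` Y = {1} \<times> {..<k}"
  proof
    show "{1} \<times> {..<k} \<subseteq> g ` Y"
    proof
      fix x assume "x \<in> {1 :: nat} \<times> {..<k}"
      then obtain i where "x = g (2, \<sigma> i)" "i < k"
        by (auto simp: g_def inv)
      then show "x \<in> g ` Y"
        by (auto simp: Y_def inv)
    qed
  qed (auto simp: g_def Y_def inv)
  have stack: "stack_diagram k (perm_diagram k \<sigma>) p = (\<lambda>c. c \<union> {y \<in> Y. g y \<in> c}) ` p"
  proof -
    have "inj_on g Y"
      by (rule inj_on_inverseI[where g = "\<lambda>(r, i). (2, \<sigma> i)"]) (auto simp: g_def Y_def inv)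
    moreover have "g ` Y \<subseteq> points k"
      by (auto simp: points_def gY)
    moreover have "points k \<inter> Y = {}"
      by (auto simp: points_def Y_def)
    ultimately have "join (points k \<union> Y) (p \<union> (\<lambda>y. {y}) ` Y)
        ((\<lambda>y. {g y, y}) ` Y \<union> (\<lambda>x. {x}) ` (points k - g ` Y)) = (\<lambda>c. c \<union> {y \<in> Y. g y \<in> c}) ` p"
      using part by (intro join_attach)
    moreover have "points k \<union> Y = {0, 1, 2} \<times> {..<k}"
      by (auto simp: points_def Y_def)
    moreover have "(\<lambda>y. {y}) ` Y = {{(2, i)} | i. i < k}"
      by (auto simp: Y_def)
    moreover have "(\<lambda>y. {g y, y}) ` Y = (`) (apfst Suc) ` perm_diagram k \<sigma>"
    proof -
      have "perm_diagram k \<sigma> = (\<lambda>i. {(0, i), (1, \<sigma> i)}) ` inv \<sigma> ` {..<k}"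
        by (auto simp: perm_diagram_def permutes_image[OF permutes_inv[OF \<sigma>]])
      moreover have "Y = Pair 2 ` {..<k}"
        by (auto simp: Y_def)
      ultimately show ?thesis
        by (simp add: g_def image_image inv numeral_2_eq_2)
    qed
    moreover have "(\<lambda>x. {x}) ` (points k - g ` Y) = {{(0, i)} | i. i < k}"
      by (auto simp: points_def gY)
    ultimately show ?thesis
      unfolding stack_diagram_def by simp
  qed
  define R :: "point \<Rightarrow> point" where "R = apfst (\<lambda>r :: nat. if r = 2 then 1 else r)"
  have R: "R ` {x \<in> c \<union> {y \<in> Y. g y \<in> c}. fst x \<noteq> 1} = ?F ` c" if "c \<in> p" for c
  proof -
    have c: "c \<subseteq> points k"
      using partition_onD1[OF part] that by blast
    have "x \<in> R ` {x \<in> c \<union> {y \<in> Y. g y \<in> c}. fst x \<noteq> 1}" if x: "x \<in> ?F ` c" for x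
    proof -
      obtain r i where ri: "(r, i) \<in> c" "x = ?F (r, i)"
        using x by auto
      then have "r = 0 \<or> r = 1" "i < k"
        using c by (auto simp: points_def)
      then show ?thesis
        using ri by (intro image_eqI[of _ _ "if r = 0 then (0, i) else (2, \<sigma> i)"])
          (auto simp: R_def Y_def g_def inv)
    qed
    moreover have "x \<in> ?F ` c" if x: "x \<in> R ` {x \<in> c \<union> {y \<in> Y. g y \<in> c}. fst x \<noteq> 1}" for x
    proof -
      obtain y where y: "y \<in> c \<union> {y \<in> Y. g y \<in> c}" "fst y \<noteq> 1" "x = R y"
        using x by blast
      obtain r i where "y = (r, i)"
        by (cases y)
      then show ?thesis
        using c y by (intro image_eqI[of _ _ "if r = 0 then (0, i) else (1, inv \<sigma> i)"])
          (auto simp: R_def Y_def g_def inv points_def)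
    qed
    ultimately show ?thesis
      by blast
  qed
  have "{} \<notin> (`) ?F ` p"
    using partition_onD3[OF part] by auto
  moreover have "comp_diagram k (perm_diagram k \<sigma>) p =
      (\<lambda>c. R ` {x \<in> c \<union> {y \<in> Y. g y \<in> c}. fst x \<noteq> 1}) ` p - {{}}"
    unfolding comp_diagram_def stack image_image R_def ..
  ultimately show ?thesis
    using R by simp
qed

lemma comp_perm_diagram_right:
  assumes p: "p \<in> diagrams k" and \<sigma>: "\<sigma> permutes {..<k}"
  shows "comp_diagram k p (perm_diagram k (inv \<sigma>)) = (`) (\<lambda>(r, i). (r, if r = 0 then \<sigma> i else i)) ` p"
    (is "_ = (`) ?F ` p")
proof -
  have part: "partition_on (points k) p"
    using p by (simp add: diagrams_def)
  define Y where "Y = {0 :: nat} \<times> {..<k}"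
  define X where "X = {1, 2 :: nat} \<times> {..<k}"
  define g where "g = (\<lambda>(r :: nat, j). (1 :: nat, inv \<sigma> j))"
  define p' where "p' = (`) (apfst Suc) ` p"
  have inv: "inv \<sigma> i < k \<longleftrightarrow> i < k" "\<sigma> (inv \<sigma> i) = i" "inv \<sigma> (\<sigma> i) = i" "\<sigma> i < k \<longleftrightarrow> i < k" for i
    using permutes_in_image[OF permutes_inv[OF \<sigma>]] permutes_in_image[OF \<sigma>] permutes_inverses[OF \<sigma>]
    by auto
  have gY: "g ` Y = {1} \<times> {..<k}"
  proof
    show "{1} \<times> {..<k} \<subseteq> g ` Y"
    proof
      fix x assume "x \<in> {1 :: nat} \<times> {..<k}"
      then obtain i where "x = g (0, \<sigma> i)" "i < k"
        by (auto simp: g_def inv)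
      then show "x \<in> g ` Y"
        by (auto simp: Y_def inv)
    qed
  qed (auto simp: g_def Y_def inv)
  have part': "partition_on X p'"
  proof -
    have "inj_on (apfst Suc :: point \<Rightarrow> point) (points k)"
      by (rule inj_onI) auto
    moreover have "apfst Suc ` points k = X"
      by (force simp: points_def X_def image_iff)
    ultimately show ?thesis
      using partition_on_image[OF part] by (metis p'_def)
  qed
  have stack: "stack_diagram k p (perm_diagram k (inv \<sigma>)) = (\<lambda>c. c \<union> {y \<in> Y. g y \<in> c}) ` p'"
  proof -
    have "inj_on g Y"
      by (rule inj_on_inverseI[where g = "\<lambda>(r, i). (0, \<sigma> i)"]) (auto simp: g_def Y_def inv)
    moreover have "g ` Y \<subseteq> X"
      by (auto simp: X_def gY)
    moreover have "X \<inter> Y = {}"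
      by (auto simp: X_def Y_def)
    ultimately have "join (X \<union> Y) (p' \<union> (\<lambda>y. {y}) ` Y)
        ((\<lambda>y. {g y, y}) ` Y \<union> (\<lambda>x. {x}) ` (X - g ` Y)) = (\<lambda>c. c \<union> {y \<in> Y. g y \<in> c}) ` p'"
      using part' by (intro join_attach)
    moreover have "X \<union> Y = {0, 1, 2} \<times> {..<k}"
      by (auto simp: X_def Y_def)
    moreover have "(\<lambda>y. {y}) ` Y = {{(0, i)} | i. i < k}"
      by (auto simp: Y_def)
    moreover have "(\<lambda>y. {g y, y}) ` Y = perm_diagram k (inv \<sigma>)"
      by (auto simp: Y_def g_def perm_diagram_def)
    moreover have "(\<lambda>x. {x}) ` (X - g ` Y) = {{(2, i)} | i. i < k}"
      by (auto simp: X_def gY)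
    ultimately show ?thesis
      unfolding stack_diagram_def p'_def by (simp add: join_commute)
  qed
  define R :: "point \<Rightarrow> point" where "R = apfst (\<lambda>r :: nat. if r = 2 then 1 else r)"
  have R: "R ` {x \<in> apfst Suc ` c \<union> {y \<in> Y. g y \<in> apfst Suc ` c}. fst x \<noteq> 1} = ?F ` c" if "c \<in> p" for c
  proof -
    have c: "c \<subseteq> points k"
      using partition_onD1[OF part] that by blast
    have Suc: "(r, i) \<in> apfst Suc ` c \<longleftrightarrow> r > 0 \<and> (r - 1, i) \<in> c" for r i
      by (force simp: image_iff)
    have "x \<in> R ` {x \<in> apfst Suc ` c \<union> {y \<in> Y. g y \<in> apfst Suc ` c}. fst x \<noteq> 1}" if x: "x \<in> ?F ` c" for x
    proof -
      obtain r i where ri: "(r, i) \<in> c" "x = ?F (r, i)"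
        using x by auto
      then have "r = 0 \<or> r = 1" "i < k"
        using c by (auto simp: points_def)
      then show ?thesis
        using ri by (intro image_eqI[of _ _ "if r = 0 then (0, \<sigma> i) else (2, i)"])
          (auto simp: R_def Y_def g_def inv Suc)
    qed
    moreover have "x \<in> ?F ` c"
      if x: "x \<in> R ` {x \<in> apfst Suc ` c \<union> {y \<in> Y. g y \<in> apfst Suc ` c}. fst x \<noteq> 1}" for x
    proof -
      obtain y where y: "y \<in> apfst Suc ` c \<union> {y \<in> Y. g y \<in> apfst Suc ` c}" "fst y \<noteq> 1" "x = R y"
        using x by blast
      obtain r i where "y = (r, i)"
        by (cases y)
      then show ?thesis
        using c y by (intro image_eqI[of _ _ "if r = 0 then (0, inv \<sigma> i) else (1, i)"])
          (auto simp: R_def Y_def g_def inv points_def Suc)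
    qed
    ultimately show ?thesis
      by blast
  qed
  have "{} \<notin> (`) ?F ` p"
    using partition_onD3[OF part] by auto
  moreover have "comp_diagram k p (perm_diagram k (inv \<sigma>)) =
      (\<lambda>c. R ` {x \<in> apfst Suc ` c \<union> {y \<in> Y. g y \<in> apfst Suc ` c}. fst x \<noteq> 1}) ` p - {{}}"
    unfolding comp_diagram_def stack p'_def image_image R_def ..
  ultimately show ?thesis
    using R by simp
qed

text \<open>The conjugation in the invariance axiom of a tracial algebra thus only renames columns.\<close>

lemma perm_diagram_conjugate:
  assumes p: "p \<in> diagrams k" and \<sigma>: "\<sigma> permutes {..<k}"
  shows "comp_diagram k (comp_diagram k (perm_diagram k \<sigma>) p) (perm_diagram k (inv \<sigma>)) =
    relabel_columns \<sigma> p"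
proof -
  have part: "partition_on (points k) p"
    using p by (simp add: diagrams_def)
  let ?F = "\<lambda>(r, i). (r :: nat, if r = 1 then \<sigma> i else i)"
  have inj: "inj_on ?F (points k)"
  proof (rule inj_onI)
    fix x y assume "?F x = ?F y"
    then show "x = y"
      using injD[OF permutes_inj[OF \<sigma>], of "snd x" "snd y"]
      by (cases x; cases y) (simp split: if_splits)
  qed
  have "\<sigma> i < k" if "i < k" for i
    using permutes_in_image[OF \<sigma>, of i] that by simp
  then have sub: "?F ` points k \<subseteq> points k"
    by (intro image_subsetI) (auto simp add: points_def split: prod.splits)
  have "?F ` points k = points k"
    by (rule endo_inj_surj[OF _ sub inj]) (simp add: points_def)
  then have "(`) ?F ` p \<in> diagrams k"
    using partition_on_image[OF part inj] by (simp add: diagrams_def)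
  then have "comp_diagram k (comp_diagram k (perm_diagram k \<sigma>) p) (perm_diagram k (inv \<sigma>)) =
      (\<lambda>c. (\<lambda>x. (\<lambda>(r, i). (r, if r = 0 then \<sigma> i else i)) (?F x)) ` c) ` p"
    by (simp only: comp_perm_diagram_left[OF assms] comp_perm_diagram_right[OF _ \<sigma>] image_image)
  also have "\<dots> = relabel_columns \<sigma> p"
    unfolding relabel_columns_def
  proof (intro image_cong refl)
    fix c x assume "c \<in> p" "x \<in> c"
    then have "x \<in> points k"
      using partition_onD1[OF part] by blast
    then show "(\<lambda>(r, i). (r, if r = 0 then \<sigma> i else i)) (?F x) = apsnd \<sigma> x"
      by (auto simp: points_def)
  qed
  finally show ?thesis .
qed

section \<open>Forms on a set of columns\<close>

text \<open>Numbering the elements of \<open>S\<close> increasingly from 0 gives the relabelling of a restricted diagram, and it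
  is also the numbering of positions in the list \<open>nths xs S\<close>.\<close>

definition rank :: "nat set \<Rightarrow> nat \<Rightarrow> nat" where
  "rank S i = card {j \<in> S. j < i}"

lemma rank_bij_betw:
  assumes "finite S"
  shows "bij_betw (rank S) S {..<card S}"
proof -
  have less: "rank S i < rank S j" if "i \<in> S" "i < j" for i j
    unfolding rank_def using assms that by (intro psubset_card_mono) auto
  have inj: "inj_on (rank S) S"
    by (rule linorder_inj_onI) (use less in fastforce)+
  have "rank S i < card S" if "i \<in> S" for i
    unfolding rank_def using assms that by (intro psubset_card_mono) auto
  then have "rank S ` S \<subseteq> {..<card S}"
    by auto
  then have "rank S ` S = {..<card S}"
    using card_image[OF inj] by (intro card_subset_eq) auto
  then show ?thesis
    using inj by (simp add: bij_betw_def)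
qed

lemma rank_lessThan: "i < k \<Longrightarrow> rank {..<k} i = i"
proof -
  assume "i < k"
  then have "{j \<in> {..<k}. j < i} = {..<i}"
    by auto
  then show ?thesis
    by (simp add: rank_def)
qed

lemma length_nths_subset:
  assumes "S \<subseteq> {..<length xs}"
  shows "length (nths xs S) = card S"
proof -
  have "{i. i < length xs \<and> i \<in> S} = S"
    using assms by auto
  then show ?thesis
    by (simp add: length_nths)
qed

lemma nths_nth_rank:
  assumes "i \<in> S" "i < length xs"
  shows "nths xs S ! rank S i = xs ! i"
  using assms(2)
proof (induction xs rule: rev_induct)
  case (snoc x xs)
  have eq: "length (nths xs S) = rank S (length xs)"
    by (simp add: length_nths rank_def conj_commute)
  show ?case
  proof (cases "i = length xs")
    case True
    then show ?thesis
      using assms(1) by (simp add: nths_append nth_append eq)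
  next
    case False
    then have "i < length xs"
      using snoc.prems by simp
    moreover have "rank S i < length (nths xs S)"
      unfolding length_nths rank_def using assms(1) calculation
      by (intro psubset_card_mono) auto
    ultimately show ?thesis
      using snoc.IH by (simp add: nths_append nth_append)
  qed
qed simp

lemma nths_nths_rank:
  assumes "finite S" "b \<subseteq> S"
  shows "nths (nths xs S) (rank S ` b) = nths xs b"
proof -
  have "{i \<in> S. \<exists>j\<in>rank S ` b. card {i' \<in> S. i' < i} = j} = b"
    using assms rank_bij_betw[OF assms(1)]
    unfolding rank_def[symmetric] bij_betw_def inj_on_def by blast
  then show ?thesis
    by (simp add: nths_nths)
qed

lemma apsnd_image_columns:
  assumes "bij_betw e S T"
  shows "inj_on (apsnd e) (R \<times> S)" "apsnd e ` (R \<times> S) = R \<times> T"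
proof -
  show "inj_on (apsnd e) (R \<times> S)"
    using bij_betw_imp_inj_on[OF assms] by (auto simp: inj_on_def)
  show "apsnd e ` (R \<times> S) = R \<times> T"
    unfolding bij_betw_imp_surj_on[OF assms, symmetric] by (force simp: image_iff)
qed

lemma relabel_columns_in_diagrams:
  assumes "partition_on ({0, 1} \<times> S) q" "bij_betw e S {..<n}"
  shows "relabel_columns e q \<in> diagrams n"
  using partition_on_image[OF assms(1) apsnd_image_columns(1)[OF assms(2)]]
  by (simp add: apsnd_image_columns(2)[OF assms(2)] relabel_columns_def diagrams_def points_def)

lemma relabel_columns_cong:
  assumes "partition_on (R \<times> S) q" "\<And>i. i \<in> S \<Longrightarrow> e i = e' i"
  shows "relabel_columns e q = relabel_columns e' q"
  unfolding relabel_columns_def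
proof (intro image_cong refl)
  fix c x assume "c \<in> q" "x \<in> c"
  then have "x \<in> R \<times> S"
    using partition_onD1[OF assms(1)] by blast
  then show "apsnd e x = apsnd e' x"
    using assms(2) by auto
qed

lemma relabel_columns_comp: "relabel_columns f (relabel_columns e q) = relabel_columns (\<lambda>i. f (e i)) q"
  by (simp add: relabel_columns_def image_image apsnd_compose[unfolded o_def])

context P_tracial_algebra
begin

text \<open>The value of a form does not depend on how a set of columns is numbered, as long as the arguments
  are numbered in the same way, because two numberings differ by a permutation. Hence it makes sense to
  speak of the form of a diagram living on an arbitrary finite set of columns.\<close>

lemma m_relabel_columns:
  assumes q: "partition_on ({0, 1} \<times> S) q"
    and e: "bij_betw e S {..<n}" and e': "bij_betw e' S {..<n}"
    and len: "length ys = n" "length zs = n"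
    and nth: "\<And>i. i \<in> S \<Longrightarrow> ys ! e i = zs ! e' i"
  shows "m (relabel_columns e q) ys = m (relabel_columns e' q) zs"
proof -
  \<comment> \<open>The change of numbering, extended by the identity to a permutation of all numbers.\<close>
  define \<sigma> where "\<sigma> = (\<lambda>j. if j < n then e' (inv_into S e j) else j)"
  have \<sigma>e: "\<sigma> (e i) = e' i" if "i \<in> S" for i
    using bij_betwE[OF e] that bij_betw_imp_inj_on[OF e] by (auto simp: \<sigma>_def)
  have "bij_betw (\<lambda>j. e' (inv_into S e j)) {..<n} {..<n}"
    using bij_betw_trans[OF bij_betw_inv_into[OF e] e'] by (simp add: o_def)
  then have "bij_betw \<sigma> {..<n} {..<n}"
    by (rule bij_betw_cong[THEN iffD1, rotated]) (simp add: \<sigma>_def)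
  then have \<sigma>: "\<sigma> permutes {..<n}"
    by (rule bij_imp_permutes) (simp add: \<sigma>_def)
  have "relabel_columns \<sigma> (relabel_columns e q) = relabel_columns e' q"
    unfolding relabel_columns_comp by (rule relabel_columns_cong[OF q]) (rule \<sigma>e)
  moreover have "map (\<lambda>j. ys ! inv \<sigma> j) [0..<n] = zs"
  proof (rule nth_equalityI)
    fix j assume "j < length (map (\<lambda>j. ys ! inv \<sigma> j) [0..<n])"
    then have j: "j < n"
      by simp
    then obtain i where i: "i \<in> S" "j = e' i"
      using bij_betw_imp_surj_on[OF e'] by (metis imageE lessThan_iff)
    then have "inv \<sigma> j = e i"
      using \<sigma>e[OF i(1)] permutes_inv_eq[OF \<sigma>] by simp
    then show "map (\<lambda>j. ys ! inv \<sigma> j) [0..<n] ! j = zs ! j"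
      using j nth[OF i(1)] i(2) by simp
  qed (simp add: len)
  ultimately show ?thesis
    using m_permute[OF relabel_columns_in_diagrams[OF q e] \<sigma> len(1)]
      perm_diagram_conjugate[OF relabel_columns_in_diagrams[OF q e] \<sigma>] by simp
qed

text \<open>The deterministic property speaks of tensor products only, where all columns of the left factor precede
  those of the right one. Numbering \<open>S\<close> first and then \<open>T\<close>, instead of numbering their union
  increasingly, turns interleaved columns into this situation.\<close>

lemma m_disjoint_columns:
  assumes det: "deterministic_family scale m A" and xs: "set xs \<subseteq> A"
    and S: "S \<subseteq> {..<length xs}" and T: "T \<subseteq> {..<length xs}" and "S \<inter> T = {}"
    and p: "partition_on ({0, 1} \<times> S) p" and q: "partition_on ({0, 1} \<times> T) q"
  shows "m (relabel_columns (rank (S \<union> T)) (p \<union> q)) (nths xs (S \<union> T)) =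
    m (relabel_columns (rank S) p) (nths xs S) * m (relabel_columns (rank T) q) (nths xs T)"
proof -
  define e where "e = (\<lambda>i. if i \<in> S then rank S i else card S + rank T i)"
  have fin: "finite S" "finite T"
    using S T by (auto intro: finite_subset)
  note rS = rank_bij_betw[OF fin(1)] and rT = rank_bij_betw[OF fin(2)]
  have notS: "i \<notin> S" if "i \<in> T" for i
    using that assms(5) by blast
  have card: "card (S \<union> T) = card S + card T"
    by (rule card_Un_disjoint[OF fin assms(5)])
  have "bij_betw ((+) (card S)) {..<card T} {card S..<card S + card T}"
    by (simp add: bij_betw_def lessThan_atLeast0 image_add_atLeastLessThan add.commute)
  from bij_betw_trans[OF rT this]
  have "bij_betw (\<lambda>i. card S + rank T i) T {card S..<card S + card T}"
    by (simp add: o_def)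
  then have "bij_betw e T {card S..<card S + card T}"
    by (rule bij_betw_cong[THEN iffD1, rotated]) (simp add: e_def notS)
  moreover have "bij_betw e S {..<card S}"
    using rS by (rule bij_betw_cong[THEN iffD1, rotated]) (simp add: e_def)
  ultimately have "bij_betw e (S \<union> T) ({..<card S} \<union> {card S..<card S + card T})"
    by (intro bij_betw_combine) auto
  also have "{..<card S} \<union> {card S..<card S + card T} = {..<card (S \<union> T)}"
    by (auto simp: card)
  finally have e: "bij_betw e (S \<union> T) {..<card (S \<union> T)}" .
  have "partition_on (({0, 1} \<times> S) \<union> ({0, 1} \<times> T)) (p \<union> q)"
    using assms(5) by (intro partition_on_Un p q) auto
  then have pq: "partition_on ({0, 1} \<times> (S \<union> T)) (p \<union> q)"
    by (simp add: Sigma_Un_distrib2)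
  note len = length_nths_subset[OF S] length_nths_subset[OF T]
  have "m (relabel_columns (rank (S \<union> T)) (p \<union> q)) (nths xs (S \<union> T)) =
      m (relabel_columns e (p \<union> q)) (nths xs S @ nths xs T)"
  proof (rule m_relabel_columns[OF pq rank_bij_betw e])
    fix i assume i: "i \<in> S \<union> T"
    then have "nths xs (S \<union> T) ! rank (S \<union> T) i = xs ! i"
      using S T by (intro nths_nth_rank) auto
    also have "\<dots> = (nths xs S @ nths xs T) ! e i"
    proof (cases "i \<in> S")
      case True
      then have "rank S i < card S"
        using bij_betwE[OF rS] by auto
      then show ?thesis
        using True S by (auto simp: e_def nth_append len nths_nth_rank)
    next
      case False
      then show ?thesis
        using i T by (auto simp: e_def nth_append len nths_nth_rank)
    qed
    finally show "nths xs (S \<union> T) ! rank (S \<union> T) i = (nths xs S @ nths xs T) ! e i" .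
  qed (use fin S T in \<open>simp_all add: length_nths_subset card\<close>)
  also have "relabel_columns e (p \<union> q) =
      tensor_diagram (card S) (relabel_columns (rank S) p) (relabel_columns (rank T) q)"
  proof -
    have "relabel_columns e p = relabel_columns (rank S) p"
      by (rule relabel_columns_cong[OF p]) (simp add: e_def)
    moreover have "relabel_columns e q = relabel_columns (\<lambda>i. card S + i) (relabel_columns (rank T) q)"
      unfolding relabel_columns_comp by (rule relabel_columns_cong[OF q]) (simp add: e_def notS)
    ultimately show ?thesis
      by (simp add: tensor_diagram_def relabel_columns_def image_Un)
  qed
  also have "m \<dots> (nths xs S @ nths xs T) =
      m (relabel_columns (rank S) p) (nths xs S) * m (relabel_columns (rank T) q) (nths xs T)"
  proof -
    have "set (nths xs U) \<subseteq> generated_algebra scale A" for U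
      using xs set_nths_subset[of xs U] by (auto intro: generated_algebra.base)
    then show ?thesis
      using det[unfolded deterministic_family_def, rule_format,
        OF relabel_columns_in_diagrams[OF p rS] relabel_columns_in_diagrams[OF q rT]] len by blast
  qed
  finally show ?thesis .
qed

end

section \<open>Moments of a classical family\<close>

definition columns :: "point set \<Rightarrow> nat set" where
  "columns b = {i. (0, i) \<in> b}"

lemma columns_points [simp]: "columns (points k) = {..<k}"
  by (auto simp: columns_def points_def)

lemma columns_Times [simp]: "columns ({0, 1} \<times> S) = S"
  by (simp add: columns_def)

text \<open>A block of a partition coarser than the identity contains with a point also the other point of the same
  column. Such partitions are therefore the same as partitions of the set of columns.\<close>

lemma block_eq_columns:
  assumes r: "refines (points k) (id_diagram k) r" and b: "b \<in> r"
  shows "b = {0, 1} \<times> columns b" "columns b \<subseteq> {..<k}" "columns b \<noteq> {}"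
proof -
  note part = refinesD(2)[OF r]
  have sub: "b \<subseteq> points k"
    using partition_onD1[OF part] b by blast
  have both: "(0, i) \<in> b \<and> (1, i) \<in> b" if x: "(0, i) \<in> b \<or> (1, i) \<in> b" for i
  proof -
    have "i < k"
      using x sub by (auto simp: points_def)
    then have "{(0, i), (1, i)} \<in> id_diagram k"
      by (auto simp: id_diagram_def)
    then obtain d where d: "d \<in> r" "{(0, i), (1, i)} \<subseteq> d"
      using refinesD(3)[OF r] by blast
    then have "d \<inter> b \<noteq> {}"
      using x by blast
    then have "d = b"
      using disjointD[OF partition_onD2[OF part] d(1) b] by blast
    then show ?thesis
      using d by blast
  qed
  show eq: "b = {0, 1} \<times> columns b"
  proof (rule set_eqI)
    fix x :: point
    obtain r i where x: "x = (r, i)"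
      by (cases x)
    show "x \<in> b \<longleftrightarrow> x \<in> {0, 1} \<times> columns b"
      using sub both[of i] unfolding x columns_def points_def by auto
  qed
  show "columns b \<subseteq> {..<k}"
    using sub by (auto simp: columns_def points_def)
  show "columns b \<noteq> {}"
    using eq b partition_onD3[OF part] by force
qed

lemma restrict_diagram_eq_relabel:
  assumes "b = {0, 1} \<times> S"
  shows "restrict_diagram p b = relabel_columns (rank S) {c \<in> p. c \<subseteq> b}"
proof -
  have "snd ` b = S"
    by (simp add: assms)
  then show ?thesis
    unfolding restrict_diagram_def relabel_columns_def rank_def by simp
qed

text \<open>Inside a block \<open>b\<close> of the join, \<open>p\<close> and the identity have join \<open>{b}\<close>, and the relabelling
  carries the identity on the columns of \<open>b\<close> to the identity diagram.\<close>

lemma irreducible_restrict_diagram: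
  assumes p: "p \<in> diagrams k" and b: "b \<in> join (points k) p (id_diagram k)"
  shows "irreducible_diagram (card (columns b)) (restrict_diagram p b)"
proof -
  have parts: "partition_on (points k) p" "partition_on (points k) (id_diagram k)"
    using p id_diagram_in_diagrams by (auto simp: diagrams_def)
  note J = refines_join[OF parts]
  note cols = block_eq_columns[OF J(2) b]
  define S where "S = columns b"
  have S: "b = {0, 1} \<times> S" "S \<subseteq> {..<k}"
    using cols by (auto simp: S_def)
  have "finite S"
    using S(2) by (rule finite_subset) simp
  note rank = rank_bij_betw[OF this]
  let ?f = "apsnd (rank S)"
  have f: "inj_on ?f b" "?f ` b = points (card S)"
    using apsnd_image_columns[OF rank, of "{0, 1}"] unfolding S(1) points_def by blast+
  have "{c \<in> id_diagram k. c \<subseteq> b} = (\<lambda>i. {(0, i), (1, i)}) ` S"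
    using S(2) by (auto simp: id_diagram_def S(1))
  then have "(`) ?f ` {c \<in> id_diagram k. c \<subseteq> b} = (\<lambda>i. {(0, i), (1, i)}) ` rank S ` S"
    by (simp add: image_image)
  also have "\<dots> = id_diagram (card S)"
    unfolding bij_betw_imp_surj_on[OF rank] id_diagram_def by auto
  finally have id: "(`) ?f ` {c \<in> id_diagram k. c \<subseteq> b} = id_diagram (card S)" .
  have "join (?f ` b) ((`) ?f ` {c \<in> p. c \<subseteq> b}) ((`) ?f ` {c \<in> id_diagram k. c \<subseteq> b}) = {?f ` b}"
    unfolding join_image[OF refines_obtains_subset[OF J(1) b] refines_obtains_subset[OF J(2) b] f(1)]
      join_block[OF parts b] by simp
  then show ?thesis
    unfolding f(2) id irreducible_diagram_def restrict_diagram_eq_relabel[OF S(1)]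
      relabel_columns_def S_def[symmetric] by simp
qed

text \<open>The blocks of \<open>p \<or> id\<close> are split off one at a time. Each restriction is irreducible, which replaces its
  form by the one of the diagram with a single block.\<close>

lemma (in P_tracial_algebra) m_classical_factorization:
  assumes cl: "classical_family scale m A" and xs: "set xs \<subseteq> A" "length xs = k"
    and p: "p \<in> diagrams k"
  shows "m p xs = (\<Prod>b\<in>join (points k) p (id_diagram k).
    m (zero_diagram (card (columns b))) (nths xs (columns b)))"
proof -
  let ?J = "join (points k) p (id_diagram k)"
  \<comment> \<open>The part of \<open>p\<close> inside the blocks in \<open>C\<close>. The factorization is proved for all sets \<open>C\<close> of
    blocks, on the columns that they cover.\<close>
  define on where "on = (\<lambda>C. \<Union>b\<in>C. {c \<in> p. c \<subseteq> b})"
  have parts: "partition_on (points k) p" "partition_on (points k) (id_diagram k)"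
    using p id_diagram_in_diagrams by (auto simp: diagrams_def)
  note J = refines_join[OF parts]
  note partJ = refinesD(2)[OF J(1)]
  note cols = block_eq_columns[OF J(2)]
  have det: "deterministic_family scale m A"
    and irr: "\<And>k p xs. p \<in> diagrams k \<Longrightarrow> irreducible_diagram k p \<Longrightarrow> length xs = k \<Longrightarrow>
      set xs \<subseteq> A \<Longrightarrow> m p xs = m (zero_diagram k) xs"
    using cl by (auto simp: classical_family_def)
  have finJ: "finite ?J"
    by (rule finite_elements[OF _ partJ]) (simp add: points_def)
  have "partition_on ({0, 1} \<times> \<Union>(columns ` C)) (on C) \<and>
      m (relabel_columns (rank (\<Union>(columns ` C))) (on C)) (nths xs (\<Union>(columns ` C))) =
      (\<Prod>b\<in>C. m (zero_diagram (card (columns b))) (nths xs (columns b)))"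
    if "finite C" "C \<subseteq> ?J" for C
    using that
  proof (induction C)
    case empty
    then show ?case
      by (simp add: on_def relabel_columns_def m_empty partition_on_empty)
  next
    case (insert b C)
    let ?S = "columns b" and ?T = "\<Union>(columns ` C)"
    have b: "b \<in> ?J" "b = {0, 1} \<times> ?S" "?S \<subseteq> {..<length xs}"
      using insert.prems cols[of b] xs(2) by auto
    have T: "?T \<subseteq> {..<length xs}"
      using insert.prems cols(2) xs(2) by blast
    have "columns b \<inter> columns d = {}" if "d \<in> C" for d
    proof -
      have "b \<inter> d = {}"
        using insert.hyps insert.prems that disjointD[OF partition_onD2[OF partJ], of b d] by blast
      then show ?thesis
        by (auto simp: columns_def)
    qed
    then have dis: "?S \<inter> ?T = {}"
      by blast
    have IH: "partition_on ({0, 1} \<times> ?T) (on C)"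
      "m (relabel_columns (rank ?T) (on C)) (nths xs ?T) =
        (\<Prod>b\<in>C. m (zero_diagram (card (columns b))) (nths xs (columns b)))"
      using insert by auto
    have pb: "partition_on ({0, 1} \<times> ?S) {c \<in> p. c \<subseteq> b}"
      using refines_obtains_subset[OF J(1) b(1)] unfolding b(2)[symmetric] .
    have on: "on (insert b C) = {c \<in> p. c \<subseteq> b} \<union> on C"
      by (simp add: on_def)
    have "partition_on ({0, 1} \<times> ?S \<union> {0, 1} \<times> ?T) (on (insert b C))"
      unfolding on using dis by (intro partition_on_Un pb IH(1)) auto
    moreover have "m (relabel_columns (rank ?S) {c \<in> p. c \<subseteq> b}) (nths xs ?S) =
        m (zero_diagram (card ?S)) (nths xs ?S)"
    proof (rule irr)
      have "finite ?S"
        using b(3) by (rule finite_subset) simp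
      then show "relabel_columns (rank ?S) {c \<in> p. c \<subseteq> b} \<in> diagrams (card ?S)"
        by (intro relabel_columns_in_diagrams[OF pb] rank_bij_betw)
      show "irreducible_diagram (card ?S) (relabel_columns (rank ?S) {c \<in> p. c \<subseteq> b})"
        using irreducible_restrict_diagram[OF p b(1)] restrict_diagram_eq_relabel[OF b(2), of p]
        by simp
      show "length (nths xs ?S) = card ?S"
        by (rule length_nths_subset[OF b(3)])
      show "set (nths xs ?S) \<subseteq> A"
        using set_nths_subset[of xs ?S] xs(1) by blast
    qed
    ultimately show ?case
      using m_disjoint_columns[OF det xs(1) b(3) T dis pb IH(1)] insert.hyps IH(2)
      by (simp add: on Sigma_Un_distrib2)
  qed
  from this[OF finJ order_refl]
  have "m (relabel_columns (rank (\<Union>(columns ` ?J))) (on ?J)) (nths xs (\<Union>(columns ` ?J))) =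
    (\<Prod>b\<in>?J. m (zero_diagram (card (columns b))) (nths xs (columns b)))"
    by blast
  moreover have "\<Union>(columns ` ?J) = {..<k}"
  proof -
    have "\<Union>(columns ` ?J) = columns (\<Union>?J)"
      by (auto simp: columns_def)
    then show ?thesis
      by (simp flip: partition_onD1[OF partJ])
  qed
  moreover have "on ?J = p"
    using refinesD(3)[OF J(1)] unfolding on_def by blast
  moreover have "relabel_columns (rank {..<k}) p = relabel_columns id p"
    by (rule relabel_columns_cong[OF parts(1)[unfolded points_def]]) (simp add: rank_lessThan)
  moreover have "relabel_columns id p = p"
    by (simp add: relabel_columns_def apsnd_def prod.map_id0)
  ultimately show ?thesis
    using xs(2) by (simp add: nths_all)
qed

section \<open>Sums over partitions\<close>

lemma bij_betw_partition_on:
  assumes "bij_betw f A B"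
  shows "bij_betw ((`) ((`) f)) {\<pi>. partition_on A \<pi>} {\<pi>. partition_on B \<pi>}"
proof -
  have fAB: "f ` A = B" "inj_on f A"
    using assms by (auto simp: bij_betw_def)
  let ?g = "inv_into A f"
  have g: "inj_on ?g B" "?g ` B = A"
    using bij_betw_inv_into[OF assms] by (auto simp: bij_betw_def)
  show ?thesis
  proof (rule bij_betw_byWitness[where f' = "(`) ((`) ?g)"])
    show "\<forall>\<pi>\<in>{\<pi>. partition_on A \<pi>}. (`) ?g ` (`) f ` \<pi> = \<pi>"
      using image_inv_into_blocks[OF _ fAB(2)] by simp
    show "\<forall>\<pi>\<in>{\<pi>. partition_on B \<pi>}. (`) f ` (`) ?g ` \<pi> = \<pi>"
    proof
      fix \<pi> assume "\<pi> \<in> {\<pi>. partition_on B \<pi>}"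
      then have "c \<subseteq> B" if "c \<in> \<pi>" for c
        using that partition_onD1[of B \<pi>] by blast
      then have "f ` ?g ` c = c" if "c \<in> \<pi>" for c
        using that by (intro image_inv_into_cancel[OF fAB(1)]) blast
      then show "(`) f ` (`) ?g ` \<pi> = \<pi>"
        by (simp add: image_image)
    qed
    show "(`) ((`) f) ` {\<pi>. partition_on A \<pi>} \<subseteq> {\<pi>. partition_on B \<pi>}"
      using partition_on_image[OF _ fAB(2)] unfolding fAB(1) by blast
    show "(`) ((`) ?g) ` {\<pi>. partition_on B \<pi>} \<subseteq> {\<pi>. partition_on A \<pi>}"
      using partition_on_image[OF _ g(1)] unfolding g(2) by blast
  qed
qed

text \<open>The recursive definition of the cumulants uses partitions of an initial segment of the numbers; numbering
  the elements of \<open>S\<close> increasingly transports it to a subset of the positions of a longer list.\<close>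

lemma classical_moment_nths:
  assumes cum: "classical_cumulants m cum" and S: "S \<subseteq> {..<length xs}"
  shows "m (zero_diagram (card S)) (nths xs S) =
    (\<Sum>\<pi> | partition_on S \<pi>. \<Prod>b\<in>\<pi>. cum (nths xs b))"
proof -
  have fin: "finite S"
    using S by (rule finite_subset) simp
  note rank = rank_bij_betw[OF fin]
  have "m (zero_diagram (card S)) (nths xs S) =
      (\<Sum>\<pi> | partition_on {..<card S} \<pi>. \<Prod>b\<in>\<pi>. cum (nths (nths xs S) b))"
    using cum[unfolded classical_cumulants_def, rule_format, of "nths xs S"]
    by (simp add: length_nths_subset[OF S])
  also have "\<dots> = (\<Sum>\<pi> | partition_on S \<pi>. \<Prod>b\<in>(`) (rank S) ` \<pi>. cum (nths (nths xs S) b))"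
    by (rule sum.reindex_bij_betw[OF bij_betw_partition_on[OF rank], symmetric])
  also have "\<dots> = (\<Sum>\<pi> | partition_on S \<pi>. \<Prod>b\<in>\<pi>. cum (nths xs b))"
  proof (rule sum.cong[OF refl])
    fix \<pi> assume "\<pi> \<in> {\<pi>. partition_on S \<pi>}"
    then have sub: "b \<subseteq> S" if "b \<in> \<pi>" for b
      using that partition_onD1[of S \<pi>] by blast
    have "inj_on ((`) (rank S)) \<pi>"
      using inj_on_subset[OF inj_on_image_Pow[OF bij_betw_imp_inj_on[OF rank]], of \<pi>] sub by blast
    then show "(\<Prod>b\<in>(`) (rank S) ` \<pi>. cum (nths (nths xs S) b)) = (\<Prod>b\<in>\<pi>. cum (nths xs b))"
      using sub by (simp add: prod.reindex nths_nths_rank[OF fin])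
  qed
  finally show ?thesis .
qed

lemma refines_remove_block:
  assumes "refines A \<pi> (insert B \<rho>)" "B \<notin> \<rho>"
  shows "refines (A - B) {c \<in> \<pi>. \<not> c \<subseteq> B} \<rho>"
proof -
  note part = refinesD(1)[OF assms(1)]
  note big = refinesD(2)[OF assms(1)]
  have \<rho>: "partition_on (A - B) \<rho>"
    using partition_on_remove[OF big, of B] assms(2) by simp
  have block: "\<exists>D\<in>\<rho>. c \<subseteq> D" if "c \<in> {c \<in> \<pi>. \<not> c \<subseteq> B}" for c
    using refinesD(3)[OF assms(1), of c] that by blast
  have "partition_on (A - B) {c \<in> \<pi>. \<not> c \<subseteq> B}"
  proof (rule partition_onI)
    have "c \<subseteq> A - B" if "c \<in> {c \<in> \<pi>. \<not> c \<subseteq> B}" for c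
      using block[OF that] partition_onD1[OF \<rho>] by blast
    moreover have "\<exists>c\<in>{c \<in> \<pi>. \<not> c \<subseteq> B}. x \<in> c" if x: "x \<in> A - B" for x
      using x partition_onD1[OF part] by blast
    ultimately show "\<Union>{c \<in> \<pi>. \<not> c \<subseteq> B} = A - B"
      by (intro equalityI Union_least subsetI) blast+
  qed (use partition_onD2[OF part] partition_onD3[OF part] in \<open>auto simp: disjnt_def disjointD\<close>)
  then show ?thesis
    unfolding refines_def using \<rho> block by blast
qed

text \<open>A refinement of a partition amounts to an independent choice of a partition of each of its blocks. A
  refinement of \<open>insert B \<rho>\<close> is separated into its blocks inside \<open>B\<close> and the others.\<close>

lemma sum_prod_refines:
  fixes g :: "'a set \<Rightarrow> 'b::comm_semiring_1"
  assumes "finite A" "partition_on A \<rho>"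
  shows "(\<Sum>\<pi> | refines A \<pi> \<rho>. \<Prod>b\<in>\<pi>. g b) = (\<Prod>B\<in>\<rho>. \<Sum>\<pi> | partition_on B \<pi>. \<Prod>b\<in>\<pi>. g b)"
  using finite_elements[OF assms] assms
proof (induction \<rho> arbitrary: A)
  case empty
  then have "A = {}"
    by (simp add: partition_on_def)
  then have "{\<pi>. refines A \<pi> {}} = {{}}"
    by (auto simp: refines_def partition_on_empty)
  then show ?case
    by simp
next
  case (insert B \<rho>)
  note part = insert.prems(2)
  have \<rho>: "partition_on (A - B) \<rho>"
    using partition_on_remove[OF part, of B] insert.hyps(2) by simp
  have B: "B \<subseteq> A" "B \<noteq> {}"
    using partition_onD1[OF part] partition_onD3[OF part] by blast+
  have finB: "finite B"
    using B(1) insert.prems(1) by (rule finite_subset)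
  let ?X = "{\<pi>. partition_on B \<pi>}" and ?Y = "{\<pi>. refines (A - B) \<pi> \<rho>}"
  let ?F = "\<lambda>\<pi>. \<Prod>b\<in>\<pi>. g b"
  have inside: "c \<subseteq> B" if "\<pi> \<in> ?X" "c \<in> \<pi>" for \<pi> c
    using that partition_onD1[of B \<pi>] by blast
  have outside: "\<not> c \<subseteq> B" if "\<pi> \<in> ?Y" "c \<in> \<pi>" for \<pi> c
  proof -
    have "partition_on (A - B) \<pi>"
      using that(1) refinesD(1) by blast
    then have "c \<subseteq> A - B" "c \<noteq> {}"
      using that(2) partition_onD1 partition_onD3 by blast+
    then show ?thesis
      by blast
  qed
  have "(\<Sum>\<pi> | refines A \<pi> (insert B \<rho>). ?F \<pi>) = (\<Sum>x\<in>?X \<times> ?Y. ?F (fst x) * ?F (snd x))"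
  proof (rule sum.reindex_bij_witness[where i = "\<lambda>x. fst x \<union> snd x"
        and j = "\<lambda>\<pi>. ({c \<in> \<pi>. c \<subseteq> B}, {c \<in> \<pi>. \<not> c \<subseteq> B})"])
    fix \<pi> assume "\<pi> \<in> {\<pi>. refines A \<pi> (insert B \<rho>)}"
    then have \<pi>: "refines A \<pi> (insert B \<rho>)"
      by simp
    show "fst ({c \<in> \<pi>. c \<subseteq> B}, {c \<in> \<pi>. \<not> c \<subseteq> B}) \<union> snd ({c \<in> \<pi>. c \<subseteq> B}, {c \<in> \<pi>. \<not> c \<subseteq> B}) = \<pi>"
      by auto
    show "({c \<in> \<pi>. c \<subseteq> B}, {c \<in> \<pi>. \<not> c \<subseteq> B}) \<in> ?X \<times> ?Y"
      using refines_obtains_subset[OF \<pi>, of B] refines_remove_block[OF \<pi> insert.hyps(2)] by simp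
    have "finite \<pi>"
      by (rule finite_elements[OF insert.prems(1) refinesD(1)[OF \<pi>]])
    then have "?F {c \<in> \<pi>. c \<subseteq> B} * ?F {c \<in> \<pi>. \<not> c \<subseteq> B} = ?F ({c \<in> \<pi>. c \<subseteq> B} \<union> {c \<in> \<pi>. \<not> c \<subseteq> B})"
      by (intro prod.union_disjoint[symmetric]) auto
    also have "{c \<in> \<pi>. c \<subseteq> B} \<union> {c \<in> \<pi>. \<not> c \<subseteq> B} = \<pi>"
      by auto
    finally show "?F (fst ({c \<in> \<pi>. c \<subseteq> B}, {c \<in> \<pi>. \<not> c \<subseteq> B})) *
        ?F (snd ({c \<in> \<pi>. c \<subseteq> B}, {c \<in> \<pi>. \<not> c \<subseteq> B})) = ?F \<pi>"
      by simp
  next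
    fix x assume x: "x \<in> ?X \<times> ?Y"
    obtain \<pi>\<^sub>1 \<pi>\<^sub>2 where eq: "x = (\<pi>\<^sub>1, \<pi>\<^sub>2)"
      by (cases x)
    then have X: "\<pi>\<^sub>1 \<in> ?X" and Y: "\<pi>\<^sub>2 \<in> ?Y"
      using x by auto
    have "{c \<in> \<pi>\<^sub>1 \<union> \<pi>\<^sub>2. c \<subseteq> B} = \<pi>\<^sub>1" "{c \<in> \<pi>\<^sub>1 \<union> \<pi>\<^sub>2. \<not> c \<subseteq> B} = \<pi>\<^sub>2"
      using inside[OF X] outside[OF Y] by blast+
    then show "({c \<in> fst x \<union> snd x. c \<subseteq> B}, {c \<in> fst x \<union> snd x. \<not> c \<subseteq> B}) = x"
      by (simp add: eq)
    have "partition_on (B \<union> (A - B)) (\<pi>\<^sub>1 \<union> \<pi>\<^sub>2)"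
      using X Y refinesD(1) by (intro partition_on_Un) auto
    moreover have "B \<union> (A - B) = A"
      using B(1) by blast
    moreover have "\<exists>D\<in>insert B \<rho>. c \<subseteq> D" if "c \<in> \<pi>\<^sub>1 \<union> \<pi>\<^sub>2" for c
      using that inside[OF X] refinesD(3)[of "A - B" \<pi>\<^sub>2 \<rho> c] Y by blast
    ultimately show "fst x \<union> snd x \<in> {\<pi>. refines A \<pi> (insert B \<rho>)}"
      unfolding eq refines_def using part by simp
  qed
  also have "\<dots> = (\<Sum>\<pi>\<in>?X. ?F \<pi>) * (\<Sum>\<pi>\<in>?Y. ?F \<pi>)"
    by (simp add: sum_product sum.cartesian_product split_def)
  also have "(\<Sum>\<pi>\<in>?Y. ?F \<pi>) = (\<Prod>B\<in>\<rho>. \<Sum>\<pi> | partition_on B \<pi>. ?F \<pi>)"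
    using insert.IH[OF _ \<rho>] insert.prems(1) by simp
  finally show ?case
    using insert.hyps by simp
qed

lemma partition_on_columns:
  assumes "refines (points k) (id_diagram k) q"
  shows "partition_on {..<k} (columns ` q)" "inj_on columns q" "(\<lambda>S. {0, 1} \<times> S) ` columns ` q = q"
proof -
  note cols = block_eq_columns[OF assms]
  have eq: "{0, 1} \<times> columns b = b" if "b \<in> q" for b
    using cols(1)[OF that] by (rule sym)
  show "(\<lambda>S. {0, 1} \<times> S) ` columns ` q = q"
    using eq by (simp add: image_image)
  show inj: "inj_on columns q"
    by (rule inj_on_inverseI[where g = "\<lambda>S. {0, 1} \<times> S"]) (rule eq)
  note part = refinesD(2)[OF assms]
  show "partition_on {..<k} (columns ` q)"
  proof (rule partition_onI)
    have "\<Union>(columns ` q) = columns (\<Union>q)"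
      by (auto simp: columns_def)
    then show "\<Union>(columns ` q) = {..<k}"
      by (simp flip: partition_onD1[OF part])
    show "{} \<notin> columns ` q"
      using cols(3) by blast
    fix c d assume "c \<in> columns ` q" "d \<in> columns ` q" "c \<noteq> d"
    then obtain c' d' where "c = columns c'" "d = columns d'" "c' \<inter> d' = {}"
      using disjointD[OF partition_onD2[OF part]] by blast
    then show "disjnt c d"
      by (auto simp: disjnt_def columns_def)
  qed
qed

lemma id_diagram_refines_Times:
  assumes "partition_on {..<k} \<pi>"
  shows "refines (points k) (id_diagram k) ((\<lambda>S. {0, 1} \<times> S) ` \<pi>)"
proof -
  have "partition_on (points k) ((\<lambda>S. {0, 1} \<times> S) ` \<pi>)"
  proof (rule partition_onI)
    have "\<Union>((\<lambda>S. {0, 1} \<times> S) ` \<pi>) = {0, 1} \<times> \<Union>\<pi>"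
      by blast
    then show "\<Union>((\<lambda>S. {0, 1} \<times> S) ` \<pi>) = points k"
      by (simp only: points_def partition_onD1[OF assms])
    have "{0, 1 :: nat} \<times> S \<noteq> {}" if "S \<in> \<pi>" for S
    proof -
      obtain i where "i \<in> S"
        using \<open>S \<in> \<pi>\<close> partition_onD3[OF assms] by (cases "S = {}") auto
      then have "(0, i) \<in> {0, 1 :: nat} \<times> S"
        by simp
      then show ?thesis
        by blast
    qed
    then show "{} \<notin> (\<lambda>S. {0, 1 :: nat} \<times> S) ` \<pi>"
      unfolding image_iff by blast
    fix c d assume "c \<in> (\<lambda>S. {0, 1 :: nat} \<times> S) ` \<pi>" "d \<in> (\<lambda>S. {0, 1 :: nat} \<times> S) ` \<pi>" "c \<noteq> d"
    then obtain S T where "c = {0, 1} \<times> S" "d = {0, 1} \<times> T" "S \<inter> T = {}"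
      using disjointD[OF partition_onD2[OF assms]] by blast
    then show "disjnt c d"
      by (auto simp: disjnt_def)
  qed
  moreover have "\<exists>d\<in>(\<lambda>S. {0, 1} \<times> S) ` \<pi>. c \<subseteq> d" if "c \<in> id_diagram k" for c
  proof -
    obtain i where i: "i < k" "c = {(0, i), (1, i)}"
      using \<open>c \<in> id_diagram k\<close> by (auto simp: id_diagram_def)
    then obtain S where "S \<in> \<pi>" "i \<in> S"
      using partition_onD1[OF assms] by blast
    then show ?thesis
      using i by (intro bexI[of _ "{0, 1} \<times> S"]) auto
  qed
  ultimately show ?thesis
    using id_diagram_in_diagrams[of k] by (simp add: refines_def diagrams_def)
qed

lemma sum_refines_columns:
  fixes g :: "nat set \<Rightarrow> 'b::comm_semiring_1"
  assumes r: "refines (points k) (id_diagram k) r"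
  shows "(\<Sum>q | refines (points k) (id_diagram k) q \<and> refines (points k) q r. \<Prod>b\<in>q. g (columns b)) =
    (\<Sum>\<pi> | refines {..<k} \<pi> (columns ` r). \<Prod>S\<in>\<pi>. g S)"
proof (rule sum.reindex_bij_witness[where j = "(`) columns" and i = "(`) (\<lambda>S. {0, 1} \<times> S)"])
  note colr = partition_on_columns[OF r]
  fix q assume "q \<in> {q. refines (points k) (id_diagram k) q \<and> refines (points k) q r}"
  then have q: "refines (points k) (id_diagram k) q" "refines (points k) q r"
    by auto
  note colq = partition_on_columns[OF q(1)]
  show "(\<lambda>S. {0, 1} \<times> S) ` columns ` q = q"
    by (rule colq(3))
  have "\<exists>d\<in>columns ` r. c \<subseteq> d" if "c \<in> columns ` q" for c
  proof -
    obtain b where b: "b \<in> q" "c = columns b"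
      using \<open>c \<in> columns ` q\<close> by blast
    then obtain d where "d \<in> r" "b \<subseteq> d"
      using refinesD(3)[OF q(2)] by blast
    then show ?thesis
      using b by (intro bexI[of _ "columns d"]) (auto simp: columns_def)
  qed
  then show "columns ` q \<in> {\<pi>. refines {..<k} \<pi> (columns ` r)}"
    using colq(1) colr(1) by (simp add: refines_def)
  show "(\<Prod>S\<in>columns ` q. g S) = (\<Prod>b\<in>q. g (columns b))"
    by (simp add: prod.reindex[OF colq(2)])
next
  note colr = partition_on_columns[OF r]
  fix \<pi> assume "\<pi> \<in> {\<pi>. refines {..<k} \<pi> (columns ` r)}"
  then have \<pi>: "refines {..<k} \<pi> (columns ` r)"
    by simp
  show "columns ` (\<lambda>S. {0, 1} \<times> S) ` \<pi> = \<pi>"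
    by (simp only: image_image columns_Times image_ident)
  have "\<exists>d\<in>r. c \<subseteq> d" if "c \<in> (\<lambda>S. {0, 1} \<times> S) ` \<pi>" for c
  proof -
    obtain S where S: "S \<in> \<pi>" "c = {0, 1} \<times> S"
      using \<open>c \<in> (\<lambda>S. {0, 1} \<times> S) ` \<pi>\<close> by blast
    then obtain T where "T \<in> columns ` r" "S \<subseteq> T"
      using refinesD(3)[OF \<pi>] by blast
    then have "{0, 1 :: nat} \<times> T \<in> (\<lambda>S. {0, 1} \<times> S) ` columns ` r" "c \<subseteq> {0, 1} \<times> T"
      using S(2) by blast+
    then show ?thesis
      unfolding colr(3) by (rule bexI[rotated])
  qed
  then show "(\<lambda>S. {0, 1} \<times> S) ` \<pi> \<in> {q. refines (points k) (id_diagram k) q \<and> refines (points k) q r}"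
    using id_diagram_refines_Times[OF refinesD(1)[OF \<pi>]] refinesD(2)[OF r]
    by (simp add: refines_def)
qed

section \<open>Cumulants of a classical family\<close>

text \<open>When \<open>q\<close> is coarser than the identity, the terms with the number of blocks of \<open>q\<close> cancel, and only the
  equality of the numbers of blocks of \<open>q \<or> p\<close> and \<open>p \<or> id\<close> remains. The former is always coarser than
  the latter, so equal numbers of blocks force equality.\<close>

lemma diagram_le_iff_refines:
  assumes p: "p \<in> diagrams k" and q: "refines (points k) (id_diagram k) q"
  shows "diagram_le k q p \<longleftrightarrow> refines (points k) q (join (points k) p (id_diagram k))"
proof -
  let ?A = "points k" and ?i = "id_diagram k"
  have fin: "finite ?A"
    by (simp add: points_def)
  have parts: "partition_on ?A p" "partition_on ?A ?i" "partition_on ?A q"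
    using p id_diagram_in_diagrams q by (auto simp: diagrams_def refines_def)
  note pi = refines_join[OF parts(1,2)] and qp = refines_join[OF parts(3,1)]
  have "join ?A ?i q = q"
    by (rule join_eqI) (use q refines_refl[OF parts(3)] in auto)
  then have le: "diagram_le k q p \<longleftrightarrow> card (join ?A q p) = card (join ?A p ?i)"
    by (auto simp: diagram_le_def diagram_dist_def join_commute[of ?A p ?i] field_simps)
  have piqp: "refines ?A (join ?A p ?i) (join ?A q p)"
    by (rule join_finest[OF parts(1,2) qp(2) refines_trans[OF q qp(1)]])
  show ?thesis
  proof
    assume "diagram_le k q p"
    then have "join ?A q p = join ?A p ?i"
      using card_refines_eq[OF fin piqp] le by simp
    then show "refines ?A q (join ?A p ?i)"
      using qp(1) by simp
  next
    assume "refines ?A q (join ?A p ?i)"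
    then have "refines ?A (join ?A q p) (join ?A p ?i)"
      by (rule join_finest[OF parts(3,1) _ pi(1)])
    then show "diagram_le k q p"
      using refines_asym[OF piqp] le by simp
  qed
qed

text \<open>The relabelling is injective and sends \<open>b\<close> to all points of the smaller diagram, so the restriction has
  a single block exactly when \<open>b\<close> is the only block of \<open>p\<close> inside \<open>b\<close>.\<close>

lemma restrict_diagram_eq_zero_iff:
  assumes p: "p \<in> diagrams k" and b: "b \<in> join (points k) p (id_diagram k)"
  shows "restrict_diagram p b = zero_diagram (card b div 2) \<longleftrightarrow> b \<in> p"
proof -
  have parts: "partition_on (points k) p" "partition_on (points k) (id_diagram k)"
    using p id_diagram_in_diagrams by (auto simp: diagrams_def)
  note J = refines_join[OF parts]
  note cols = block_eq_columns[OF J(2) b]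
  define S where "S = columns b"
  have S: "b = {0, 1} \<times> S" "S \<subseteq> {..<k}" "S \<noteq> {}"
    using cols by (auto simp: S_def)
  have "finite S"
    using S(2) by (rule finite_subset) simp
  note rank = rank_bij_betw[OF this]
  let ?f = "apsnd (rank S)" and ?pb = "{c \<in> p. c \<subseteq> b}"
  have f: "inj_on ?f b" "?f ` b = points (card S)"
    using apsnd_image_columns[OF rank, of "{0, 1}"] unfolding S(1) points_def by blast+
  have pb: "partition_on b ?pb"
    by (rule refines_obtains_subset[OF J(1) b])
  have "card b div 2 = card S"
    by (simp add: S(1) card_cartesian_product)
  moreover have "?f ` b \<noteq> {}"
    using S by auto
  ultimately have "zero_diagram (card b div 2) = (`) ?f ` {b}"
    by (auto simp: zero_diagram_def f(2))
  moreover have "restrict_diagram p b = (`) ?f ` ?pb"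
    unfolding restrict_diagram_eq_relabel[OF S(1)] relabel_columns_def ..
  ultimately have "restrict_diagram p b = zero_diagram (card b div 2) \<longleftrightarrow> (`) ?f ` ?pb = (`) ?f ` {b}"
    by simp
  also have "\<dots> \<longleftrightarrow> ?pb = {b}"
    by (rule inj_on_image_eq_iff[OF inj_on_image_Pow[OF f(1)]]) auto
  also have "\<dots> \<longleftrightarrow> b \<in> p"
  proof
    assume "b \<in> p"
    then have "b \<in> ?pb"
      by blast
    from partition_on_remove[OF pb this] have "?pb - {b} = {}"
      by (simp add: partition_on_empty)
    then show "?pb = {b}"
      using \<open>b \<in> ?pb\<close> by blast
  qed blast
  finally show ?thesis .
qed

text \<open>If all blocks of \<open>p \<or> id\<close> are blocks of \<open>p\<close>, then \<open>p \<or> id = p\<close>; otherwise one of the factors is 0.\<close>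

lemma cumulant_product_eq:
  fixes cum :: "'a list \<Rightarrow> complex"
  assumes p: "p \<in> diagrams k"
  shows "(\<Prod>b\<in>join (points k) p (id_diagram k).
      of_bool (restrict_diagram p b = zero_diagram (card b div 2)) * cum (nths xs {i. (0, i) \<in> b})) =
    (if refines (points k) (id_diagram k) p then \<Prod>b\<in>p. cum (nths xs (columns b)) else 0)"
proof -
  let ?J = "join (points k) p (id_diagram k)"
  have parts: "partition_on (points k) p" "partition_on (points k) (id_diagram k)"
    using p id_diagram_in_diagrams by (auto simp: diagrams_def)
  note J = refines_join[OF parts]
  have finJ: "finite ?J"
    by (rule finite_elements[OF _ refinesD(2)[OF J(1)]]) (simp add: points_def)
  have eq: "(\<Prod>b\<in>?J. of_bool (restrict_diagram p b = zero_diagram (card b div 2)) *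
      cum (nths xs {i. (0, i) \<in> b})) = (\<Prod>b\<in>?J. of_bool (b \<in> p) * cum (nths xs (columns b)))"
    by (intro prod.cong refl) (simp add: restrict_diagram_eq_zero_iff[OF p] columns_def)
  show ?thesis
  proof (cases "refines (points k) (id_diagram k) p")
    case True
    have "?J = p"
      by (rule join_eqI) (use True refines_refl[OF parts(1)] in auto)
    then show ?thesis
      using True eq by simp
  next
    case False
    have "\<not> ?J \<subseteq> p"
    proof
      assume "?J \<subseteq> p"
      then have "refines (points k) ?J p"
        using refinesD(2)[OF J(1)] parts(1) unfolding refines_def by blast
      then show False
        using refines_trans[OF J(2)] False by blast
    qed
    then have "(\<Prod>b\<in>?J. of_bool (b \<in> p) * cum (nths xs (columns b))) = 0"
      using finJ by (intro prod_zero) auto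
    then show ?thesis
      using False eq by simp
  qed
qed

text \<open>The triangular inversion that makes the cumulants unique, for a fixed list of arguments: this is the form
  that is needed when a relation is only known for arguments in the family.\<close>

lemma diagram_sums_determine:
  fixes f g :: "diagram \<Rightarrow> complex"
  assumes eq: "\<And>p. p \<in> diagrams k \<Longrightarrow>
      (\<Sum>q | q \<in> diagrams k \<and> diagram_le k q p. f q) = (\<Sum>q | q \<in> diagrams k \<and> diagram_le k q p. g q)"
    and p: "p \<in> diagrams k"
  shows "f p = g p"
  using p
proof (induction "diagram_rank k p" arbitrary: p rule: less_induct)
  case less
  let ?L = "{q. q \<in> diagrams k \<and> diagram_le k q p \<and> q \<noteq> p}"
  have "(\<Sum>q\<in>?L. f q) = (\<Sum>q\<in>?L. g q)"
    using less by (intro sum.cong) (auto intro: diagram_rank_less)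
  then show ?case
    using eq[OF less.prems] unfolding sum_diagram_le[OF less.prems] by simp
qed

theorem theorem2p10:
  fixes scale :: "complex \<Rightarrow> 'a::ring \<Rightarrow> 'a"
    and m \<kappa> :: "diagram \<Rightarrow> 'a list \<Rightarrow> complex"
    and cum :: "'a list \<Rightarrow> complex"
    and A\<^sub>1 :: "'a set" and k :: nat and p :: diagram and xs :: "'a list"
  assumes "P_tracial_algebra scale m"
    and "P_cumulants scale m \<kappa>"
    and "classical_cumulants m cum"
    and "classical_family scale m A\<^sub>1"
    and "p \<in> diagrams k"
    and "length xs = k" and "set xs \<subseteq> A\<^sub>1"
  shows "\<kappa> p xs =
    (\<Prod>b\<in>join (points k) p (id_diagram k).
       of_bool (restrict_diagram p b = zero_diagram (card b div 2)) *
       cum (nths xs {i. (0, i) \<in> b}))"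
proof -
  interpret P_tracial_algebra scale m
    by fact
  let ?A = "points k" and ?i = "id_diagram k"
  let ?c = "\<lambda>q. \<Prod>b\<in>q. cum (nths xs (columns b))"
  define K where "K = (\<lambda>q. if refines ?A ?i q then ?c q else 0)"
  have "(\<Sum>q | q \<in> diagrams k \<and> diagram_le k q r. \<kappa> q xs) =
      (\<Sum>q | q \<in> diagrams k \<and> diagram_le k q r. K q)" if r: "r \<in> diagrams k" for r
  proof -
    let ?J = "join ?A r ?i"
    have parts: "partition_on ?A r" "partition_on ?A ?i"
      using r id_diagram_in_diagrams by (auto simp: diagrams_def)
    note J = refines_join(2)[OF parts]
    note colJ = partition_on_columns[OF J]
    have "(\<Sum>q | q \<in> diagrams k \<and> diagram_le k q r. \<kappa> q xs) = m r xs"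
      using assms(2,6) r by (simp add: P_cumulants_def)
    also have "\<dots> = (\<Prod>b\<in>?J. m (zero_diagram (card (columns b))) (nths xs (columns b)))"
      by (rule m_classical_factorization[OF assms(4,7,6) r])
    also have "\<dots> = (\<Prod>b\<in>?J. \<Sum>\<pi> | partition_on (columns b) \<pi>. \<Prod>S\<in>\<pi>. cum (nths xs S))"
      using block_eq_columns(2)[OF J] assms(6)
      by (intro prod.cong refl classical_moment_nths[OF assms(3)]) simp
    also have "\<dots> = (\<Prod>B\<in>columns ` ?J. \<Sum>\<pi> | partition_on B \<pi>. \<Prod>S\<in>\<pi>. cum (nths xs S))"
      by (simp add: prod.reindex[OF colJ(2)])
    also have "\<dots> = (\<Sum>\<pi> | refines {..<k} \<pi> (columns ` ?J). \<Prod>S\<in>\<pi>. cum (nths xs S))"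
      by (rule sum_prod_refines[OF _ colJ(1), symmetric]) simp
    also have "\<dots> = (\<Sum>q | refines ?A ?i q \<and> refines ?A q ?J. ?c q)"
      by (rule sum_refines_columns[OF J, symmetric])
    also have "\<dots> = (\<Sum>q | refines ?A ?i q \<and> refines ?A q ?J. K q)"
      by (rule sum.cong) (simp_all add: K_def)
    \<comment> \<open>The remaining diagrams below \<open>r\<close> are not coarser than the identity, where \<open>K\<close> vanishes.\<close>
    also have "\<dots> = (\<Sum>q | q \<in> diagrams k \<and> diagram_le k q r. K q)"
    proof (rule sum.mono_neutral_left)
      show "finite {q. q \<in> diagrams k \<and> diagram_le k q r}"
        by (rule finite_subset[OF _ finite_diagrams]) blast
      show "{q. refines ?A ?i q \<and> refines ?A q ?J} \<subseteq> {q. q \<in> diagrams k \<and> diagram_le k q r}"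
        using diagram_le_iff_refines[OF r] refinesD(2) by (auto simp: diagrams_def)
      show "\<forall>q\<in>{q. q \<in> diagrams k \<and> diagram_le k q r} - {q. refines ?A ?i q \<and> refines ?A q ?J}. K q = 0"
        using diagram_le_iff_refines[OF r] by (auto simp: K_def)
    qed
    finally show ?thesis .
  qed
  then have "\<kappa> p xs = K p"
    using diagram_sums_determine[of k "\<lambda>q. \<kappa> q xs" K] assms(5) by blast
  then show ?thesis
    unfolding cumulant_product_eq[OF assms(5)] K_def .
qed

end
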